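(* Let $n\geq 1$ and $0\le k<n$ be integers. Then $$\int_0^\infty\frac{\sinh^{2k+1}x}{x\cosh^{2n+1}x}\,dx=\sum_{p=1}^{n}(2^{2p+1}-1)\,\Bigl([z^{2n}](z^2-1)^k(\arcsin z)^{2p}\Bigr)\frac{\zeta(2p+1)}{\pi^{2p}},$$ and $$\int_0^\infty\frac{\sinh^{2k+1}x}{x\cosh^{2n}x}\,dx=\sum_{p=1}^{n}2^{2p}\,\Bigl([z^{2n-1}](z^2-1)^k(\arcsin z)^{2p-1}\Bigr)\frac{\beta(2p)}{\pi^{2p-1}}.$$
   Context: $\zeta$ is the Riemann zeta function and $\beta$ is the Dirichlet beta function, $\beta(s)=\sum_{r\ge0}(-1)^r(2r+1)^{-s}$. $[z^r]F(z)$ denotes the coefficient of $z^r$ in the expansion of $F$ at the origin; $\arcsin$ is the principal branch. *)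

theory Defs
  imports "HOL-Complex_Analysis.Complex_Analysis"
begin

(* The Dirichlet series agrees with the Riemann zeta function for Re s > 1; it does not
   give the analytic continuation to other s. *)
definition riemann_zeta :: "complex \<Rightarrow> complex" where
  "riemann_zeta s = (\<Sum>r. of_nat (Suc r) powr (- s))"

(* The series converges (conditionally, for Re s \<le> 1) when Re s > 0; as above, the analytic
   continuation to other s is not included. *)
definition dirichlet_beta :: "complex \<Rightarrow> complex" where
  "dirichlet_beta s = (\<Sum>r. (-1) ^ r * of_nat (2 * r + 1) powr (- s))"

end

(* With e = (-1)^s and b_j = pi (j + 1/2), the partial fraction expansion
     sinh x / cosh x^(s+1) = 2 * sum_{m=1..s} ([z^s] arcsin^m z) * sum_j e^j Im (b_j - i x)^(-m-1)
   is obtained from those of cot (s even) and 1/sin (s odd) by induction s -> s+2: both sides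
   satisfy the recurrence that twofold differentiation yields for cos u / sin^(s+1) u on the left
   and that (1 - z^2) y'' - z y' = m (m - 1) arcsin^(m-2) z, y = arcsin^m z, yields for the
   coefficients on the right. Each sech_pole contributes
     integral_0^infinity Im (b - i x)^(-m-1) / x dx = (pi / 2) b^(-m-1),
   and the sums over j are values of zeta and beta. This settles k = 0; the case of k + 1 follows
   from that of k by cosh^2 - sinh^2 = 1, which matches the factor z^2 - 1 in the coefficients. *)

theory Submission
  imports Defs "HOL-Real_Asymp.Real_Asymp"
begin

text \<open>Both formulas are one statement in s, the exponent of cosh less one: s = 2n leads to
  zeta, s = 2n - 1 to beta. Shifting z by 1 multiplies cos (pi z) / sin (pi z)^(s+1) by (-1)^s,
  which explains the signs e^j and the split into cot and 1/sin. The hyperbolic quotient appears at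
  z = 1/2 - i x / pi. On this line z -> 1 - z is complex conjugation, so the terms of j and -j-1
  combine to an imaginary part; this needs s + m even, and the coefficients with s + m odd vanish
  because arcsin is odd. The obstacle is m = 0, where the series does not converge absolutely.
  Polygamma functions stand in for the series: m = 0 becomes the reflection formula of Digamma,
  differentiation just raises m, and series are used only for m >= 1. For s >= 1 the coefficient of
  m = 0 is zero, so only absolutely convergent series are integrated.\<close>

subsection \<open>Coefficients of powers of the arcsine\<close>

definition arcsin_fps :: "complex fps" where
  "arcsin_fps = fps_expansion Arcsin 0"

lemma Arcsin_holomorphic_unit_ball: "Arcsin holomorphic_on ball 0 1"
proof (rule holomorphic_on_Arcsin)
  fix z :: complex assume "z \<in> ball 0 1"
  then show "\<bar>Re z\<bar> < 1"
    using abs_Re_le_cmod[of z] by simp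
qed

lemma has_fps_expansion_Arcsin: "Arcsin has_fps_expansion arcsin_fps"
  unfolding arcsin_fps_def
  by (rule has_fps_expansion_fps_expansion[of "ball 0 1"])
     (auto intro: Arcsin_holomorphic_unit_ball)

text \<open>The derivative of arcsin is 1 / cos (arcsin z), and cos (arcsin z)^2 = 1 - z^2; squaring
  avoids the power series of a square root.\<close>

lemma arcsin_fps_ode: "(1 - fps_X ^ 2) * fps_deriv arcsin_fps ^ 2 = 1"
proof -
  have d: "deriv Arcsin has_fps_expansion fps_deriv arcsin_fps"
    by (rule has_fps_expansion_deriv[OF has_fps_expansion_Arcsin])
  have "(\<lambda>z. (1 - z ^ 2) * deriv Arcsin z ^ 2) has_fps_expansion
          (1 - fps_X ^ 2) * fps_deriv arcsin_fps ^ 2"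
    by (intro fps_expansion_intros d)
  moreover have "eventually (\<lambda>z::complex. z \<in> ball 0 1) (nhds 0)"
    by (rule eventually_nhds_in_open) auto
  then have "eventually (\<lambda>z. (1 - z ^ 2) * deriv Arcsin z ^ 2 = (1::complex)) (nhds 0)"
  proof eventually_elim
    case (elim z)
    have "\<bar>Re z\<bar> < 1"
      using elim abs_Re_le_cmod[of z] by simp
    then have "(Arcsin has_field_derivative inverse (cos (Arcsin z))) (at z)"
      by (intro has_field_derivative_Arcsin) auto
    then have "deriv Arcsin z = inverse (cos (Arcsin z))"
      by (rule DERIV_imp_deriv)
    moreover have "z\<^sup>2 \<noteq> 1"
    proof
      assume "z\<^sup>2 = 1"
      then have "z = 1 \<or> z = -1"
        by (simp add: power2_eq_1_iff)
      then show False
        using elim by auto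
    qed
    then have "cos (Arcsin z) \<noteq> 0"
      by (rule cos_Arcsin_nonzero)
    moreover have "cos (Arcsin z) ^ 2 = 1 - z ^ 2"
      using sin_cos_squared_add2[of "Arcsin z"] by (simp add: algebra_simps)
    ultimately show ?case
      by (metis power_inverse power_not_zero right_inverse)
  qed
  ultimately have "(\<lambda>z. 1) has_fps_expansion (1 - fps_X ^ 2) * fps_deriv arcsin_fps ^ 2"
    using has_fps_expansion_cong by fastforce
  then show ?thesis
    using has_fps_expansion_1 fps_expansion_unique_complex by blast
qed

lemma arcsin_fps_nth_0: "fps_nth arcsin_fps 0 = 0"
  unfolding arcsin_fps_def by (simp add: fps_expansion_def)

lemma arcsin_fps_nth_1: "fps_nth arcsin_fps 1 = 1"
proof -
  have "(Arcsin has_field_derivative inverse (cos (Arcsin 0))) (at 0)"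
    by (intro has_field_derivative_Arcsin) auto
  then show ?thesis
    unfolding arcsin_fps_def by (simp add: fps_expansion_def DERIV_imp_deriv)
qed

text \<open>Differentiating \<open>arcsin_fps_ode\<close> and cancelling 2 y' gives the linear
  equation (1 - X^2) y'' = X y' for y = \<open>arcsin_fps\<close>; this and the squared equation
  eliminate the derivatives of y from those of y^m. For m < 2 the truncated \<open>m - 2\<close> is
  harmless, since m (m - 1) = 0.\<close>

lemma arcsin_fps_power_ode:
  "(1 - fps_X ^ 2) * fps_deriv (fps_deriv (arcsin_fps ^ m)) - fps_X * fps_deriv (arcsin_fps ^ m)
     = of_nat (m * (m - 1)) * arcsin_fps ^ (m - 2)"
proof -
  let ?S = arcsin_fps and ?d = "fps_deriv arcsin_fps"
  let ?dd = "fps_deriv ?d"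
  have nz: "?d \<noteq> 0"
  proof
    assume "?d = 0"
    then show False
      using arcsin_fps_ode by (simp only: zero_power2 mult_zero_right zero_neq_one)
  qed
  have "fps_deriv ((1 - fps_X ^ 2) * ?d ^ 2) = 0"
    by (simp add: arcsin_fps_ode)
  then have "2 * ?d * ((1 - fps_X ^ 2) * ?dd - fps_X * ?d) = 0"
    by (simp add: power2_eq_square algebra_simps)
  then have dd: "(1 - fps_X ^ 2) * ?dd = fps_X * ?d"
    using nz by simp
  consider "m = 0" | "m = 1" | j where "m = Suc (Suc j)"
    by (metis One_nat_def not0_implies_Suc)
  then show ?thesis
  proof cases
    case 3
    have d1: "fps_deriv (?S ^ m) = of_nat m * ?S ^ Suc j * ?d"
      unfolding 3 by (simp add: fps_deriv_power algebra_simps fps_of_nat del: power_Suc of_nat_Suc)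
    have d2: "fps_deriv (fps_deriv (?S ^ m)) =
            of_nat m * (of_nat (Suc j) * ?S ^ j * ?d ^ 2 + ?S ^ Suc j * ?dd)"
      unfolding d1 by (simp add: fps_deriv_power algebra_simps fps_of_nat power2_eq_square del: power_Suc of_nat_Suc)
    have "(1 - fps_X ^ 2) * fps_deriv (fps_deriv (?S ^ m)) - fps_X * fps_deriv (?S ^ m)
        = of_nat m * (of_nat (Suc j) * ?S ^ j * ((1 - fps_X ^ 2) * ?d ^ 2)
            + ?S ^ Suc j * ((1 - fps_X ^ 2) * ?dd)) - fps_X * (of_nat m * ?S ^ Suc j * ?d)"
      unfolding d2 unfolding d1 by (simp only: algebra_simps)
    also have "\<dots> = of_nat (m * (m - 1)) * ?S ^ (m - 2)"
      unfolding dd arcsin_fps_ode 3 by (simp add: algebra_simps)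
    finally show ?thesis .
  qed (auto simp: dd)
qed

definition arcsin_coeff :: "nat \<Rightarrow> nat \<Rightarrow> nat \<Rightarrow> complex" where
  "arcsin_coeff k s m = fps_nth ((fps_X ^ 2 - 1) ^ k * arcsin_fps ^ m) s"

lemma fps_nth_expansion_Arcsin:
  "fps_nth (fps_expansion (\<lambda>z. (z ^ 2 - 1) ^ k * Arcsin z ^ m) 0) s = arcsin_coeff k s m"
proof -
  have "(\<lambda>z. (z ^ 2 - 1) ^ k * Arcsin z ^ m) has_fps_expansion
          (fps_X ^ 2 - 1) ^ k * arcsin_fps ^ m"
    by (intro fps_expansion_intros has_fps_expansion_Arcsin)
  then show ?thesis
    by (simp add: fps_expansion_eqI arcsin_coeff_def)
qed

lemma arcsin_coeff_eq_0_if_less: "s < m \<Longrightarrow> arcsin_coeff k s m = 0"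
proof -
  assume "s < m"
  have "fps_nth (arcsin_fps ^ m) j = 0" if "j \<le> s" for j
    using that \<open>s < m\<close> by (simp add: startsby_zero_power_prefix arcsin_fps_nth_0)
  then show ?thesis
    unfolding arcsin_coeff_def fps_mult_nth by (intro sum.neutral) auto
qed

text \<open>The coefficient of X^s in \<open>arcsin_fps_power_ode\<close>: X^2 y'' and X y' together
  contribute the factor s (s - 1) + s = s^2.\<close>

lemma arcsin_coeff_rec:
  "of_nat ((s + 1) * (s + 2)) * arcsin_coeff 0 (s + 2) m =
     of_nat (s\<^sup>2) * arcsin_coeff 0 s m + of_nat (m * (m - 1)) * arcsin_coeff 0 s (m - 2)"
proof -
  let ?y = "arcsin_fps ^ m"
  have "fps_nth ((1 - fps_X ^ 2) * fps_deriv (fps_deriv ?y) - fps_X * fps_deriv ?y) s =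
        of_nat (m * (m - 1)) * fps_nth (arcsin_fps ^ (m - 2)) s"
    unfolding arcsin_fps_power_ode by (metis fps_mult_left_const_nth fps_of_nat)
  moreover have "fps_nth ((1 - fps_X ^ 2) * fps_deriv (fps_deriv ?y) - fps_X * fps_deriv ?y) s =
      of_nat ((s + 1) * (s + 2)) * fps_nth ?y (s + 2) - of_nat (s\<^sup>2) * fps_nth ?y s"
  proof -
    consider "s = 0" | "s = 1" | j where "s = Suc (Suc j)"
      by (metis One_nat_def not0_implies_Suc)
    then show ?thesis
      by cases (simp_all add: left_diff_distrib fps_X_power_mult_nth algebra_simps power2_eq_square
                  numeral_2_eq_2)
  qed
  ultimately show ?thesis
    by (simp add: arcsin_coeff_def algebra_simps)
qed

lemma arcsin_coeff_rec_Suc: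
  "arcsin_coeff (Suc k) (s + 2) m = arcsin_coeff k s m - arcsin_coeff k (s + 2) m"
proof -
  have *: "(fps_X ^ 2 - 1) ^ Suc k * arcsin_fps ^ m =
        fps_X ^ 2 * ((fps_X ^ 2 - 1) ^ k * arcsin_fps ^ m) - (fps_X ^ 2 - 1) ^ k * arcsin_fps ^ m"
    by (simp add: algebra_simps)
  show ?thesis
    unfolding arcsin_coeff_def * by (simp add: fps_X_power_mult_nth)
qed

lemma arcsin_coeff_0:
  "arcsin_coeff 0 0 m = (if m = 0 then 1 else 0)"
  by (simp add: arcsin_coeff_def arcsin_fps_nth_0 fps_power_zeroth)

lemma arcsin_coeff_1:
  "arcsin_coeff 0 1 m = (if m = 1 then 1 else 0)"
proof -
  consider "m = 0" | "m = 1" | "1 < m" by linarith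
  then show ?thesis
    by cases (auto simp: arcsin_coeff_eq_0_if_less, auto simp: arcsin_coeff_def arcsin_fps_nth_1[simplified])
qed

text \<open>This is the oddness of arcsin, read off the recurrence: it links only coefficients with
  the same parity of s + m.\<close>

lemma arcsin_coeff_0_eq_0_if_odd:
  "odd (s + m) \<Longrightarrow> arcsin_coeff 0 s m = 0"
proof (induction s arbitrary: m rule: induct_nat_012)
  case 0
  then show ?case by (cases m) (auto simp: arcsin_coeff_0)
next
  case 1
  then show ?case using arcsin_coeff_1 by auto
next
  case (ge2 s)
  have "arcsin_coeff 0 s m = 0"
    using ge2 by simp
  \<comment> \<open>For m < 2 the truncated \<open>m - 2\<close> may have the wrong parity, but then
    the factor m (m - 1) is zero.\<close>
  moreover have "of_nat (m * (m - 1)) * arcsin_coeff 0 s (m - 2) = 0"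
  proof (cases "m < 2")
    case True
    then have "m * (m - 1) = 0" by (cases m) auto
    then show ?thesis by (metis mult_eq_0_iff of_nat_0)
  qed (use ge2 in auto)
  ultimately have "of_nat ((s + 1) * (s + 2)) * arcsin_coeff 0 (s + 2) m = 0"
    by (simp only: arcsin_coeff_rec) simp
  then have "arcsin_coeff 0 (s + 2) m = 0"
    by (simp only: mult_eq_0_iff of_nat_eq_0_iff) simp
  then show ?case
    by simp
qed

lemma arcsin_coeff_eq_0_if_odd:
  "odd (s + m) \<Longrightarrow> arcsin_coeff k s m = 0"
proof (induction k arbitrary: s)
  case 0
  then show ?case by (rule arcsin_coeff_0_eq_0_if_odd)
next
  case (Suc k)
  show ?case
  proof (cases "s < 2")
    case True
    \<comment> \<open>For s < 2 the summand shifted by X^2 has no coefficient at s, so only the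
      summand from -1 survives.\<close>
    have "arcsin_coeff (Suc k) s m = fps_nth (fps_X ^ 2 * ((fps_X ^ 2 - 1) ^ k * arcsin_fps ^ m) - (fps_X ^ 2 - 1) ^ k * arcsin_fps ^ m) s"
      unfolding arcsin_coeff_def by (simp add: algebra_simps)
    also have "\<dots> = - arcsin_coeff k s m"
      using True by (simp add: fps_X_power_mult_nth arcsin_coeff_def)
    finally show ?thesis
      using Suc by simp
  next
    case False
    then obtain t where "s = t + 2"
      by (metis le_add_diff_inverse2 not_less)
    then show ?thesis
      using Suc arcsin_coeff_rec_Suc[of k t m] by simp
  qed
qed

subsection \<open>Partial fractions of the cotangent and cosecant\<close>

lemma open_unit_strip_nonzero:
  fixes w :: complex
  assumes "0 < Re w" "Re w < 1"
  shows "sin (of_real pi * w) \<noteq> 0" "w \<notin> \<int>\<^sub>\<le>\<^sub>0" "1 - w \<notin> \<int>\<^sub>\<le>\<^sub>0"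
proof -
  have w: "w \<notin> \<int>"
    using assms by (auto elim!: Ints_cases)
  have w': "1 - w \<notin> \<int>"
    using w by (metis Ints_1 Ints_diff diff_diff_eq2 add_diff_cancel_left')
  show "w \<notin> \<int>\<^sub>\<le>\<^sub>0" "1 - w \<notin> \<int>\<^sub>\<le>\<^sub>0"
    using w w' nonpos_Ints_Int by blast+
  show "sin (of_real pi * w) \<noteq> 0"
    using w by (auto simp: sin_eq_0 mult.commute)
qed

text \<open>The logarithmic derivative of Gamma z * Gamma (1 - z) = pi / sin (pi z): both sides are
  differentiated, and the nonzero factor pi / sin (pi z) is cancelled.\<close>

lemma Digamma_reflection:
  fixes z :: complex
  assumes "0 < Re z" "Re z < 1"
  shows "Digamma (1 - z) - Digamma z = pi * cot (pi * z)"
proof -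
  note nz = open_unit_strip_nonzero[OF assms]
  have "((\<lambda>w. Gamma w * Gamma (1 - w)) has_field_derivative
          Gamma z * Gamma (1 - z) * (Digamma z - Digamma (1 - z))) (at z)"
    using nz by (auto intro!: derivative_eq_intros simp: algebra_simps)
  then have "((\<lambda>w. of_real pi / sin (of_real pi * w)) has_field_derivative
          Gamma z * Gamma (1 - z) * (Digamma z - Digamma (1 - z))) (at z)"
    by (simp add: Gamma_reflection_complex)
  moreover have "((\<lambda>w. of_real pi / sin (of_real pi * w)) has_field_derivative
          - (of_real pi / sin (of_real pi * z)) * (pi * cot (pi * z))) (at z)"
    using nz by (auto intro!: derivative_eq_intros simp: cot_def field_simps)
  ultimately have "Gamma z * Gamma (1 - z) * (Digamma z - Digamma (1 - z)) =
      - (of_real pi / sin (of_real pi * z)) * (pi * cot (pi * z))"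
    by (rule DERIV_unique)
  then have "(of_real pi / sin (of_real pi * z)) * (Digamma (1 - z) - Digamma z - pi * cot (pi * z)) = 0"
    by (simp only: Gamma_reflection_complex) (simp add: algebra_simps)
  then show ?thesis
    using nz by simp
qed

(* For m > 0, cot_pfd m z is the sum of (z + j)^(-m-1) over all integers j; csc_pfd m z below is the
   same sum with signs (-1)^j. *)
definition cot_pfd :: "nat \<Rightarrow> complex \<Rightarrow> complex" where
  "cot_pfd m z = ((-1) ^ m * Polygamma m (1 - z) - Polygamma m z) * (-1) ^ m / fact m"

lemma has_field_derivative_cot_pfd:
  assumes "0 < Re z" "Re z < 1"
  shows "(cot_pfd m has_field_derivative - of_nat (Suc m) * cot_pfd (Suc m) z) (at z)"
proof -
  have "((\<lambda>w. Polygamma m (1 - w)) has_field_derivative Polygamma (Suc m) (1 - z) * (- 1)) (at z)"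
    by (rule DERIV_chain2[OF has_field_derivative_Polygamma])
       (use open_unit_strip_nonzero[OF assms] in \<open>auto intro!: derivative_eq_intros\<close>)
  then have "((\<lambda>w. ((-1) ^ m * Polygamma m (1 - w) - Polygamma m w) * ((-1) ^ m / fact m))
      has_field_derivative ((-1) ^ m * (Polygamma (Suc m) (1 - z) * (- 1)) - Polygamma (Suc m) z)
        * ((-1) ^ m / fact m)) (at z)"
    by (intro DERIV_cmult_right DERIV_diff DERIV_cmult has_field_derivative_Polygamma open_unit_strip_nonzero[OF assms])
  moreover have "a / fact m = of_nat (Suc m) * (a / fact (Suc m))" for a :: complex
    by (simp add: field_simps del: of_nat_Suc)
  then have "((-1) ^ m * (Polygamma (Suc m) (1 - z) * (- 1)) - Polygamma (Suc m) z) * ((-1) ^ m / fact m)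
      = - of_nat (Suc m) * cot_pfd (Suc m) z"
    unfolding cot_pfd_def by (simp add: algebra_simps diff_divide_distrib add_divide_distrib
        del: of_nat_Suc fact_Suc)
  moreover have "cot_pfd m = (\<lambda>w. ((-1) ^ m * Polygamma m (1 - w) - Polygamma m w) * ((-1) ^ m / fact m))"
    by (simp add: cot_pfd_def fun_eq_iff)
  ultimately show ?thesis
    by (simp only:)
qed

lemma cot_pfd_0:
  assumes "0 < Re z" "Re z < 1"
  shows "cot_pfd 0 z = of_real pi * cos (of_real pi * z) / sin (of_real pi * z)"
  using Digamma_reflection[OF assms] by (simp add: cot_pfd_def cot_def)

text \<open>The integers are folded into pairs j and -j-1 with j >= 0: z + (-j-1) = -(1 - z + j),
  whence the sign (-1)^(m+1). Each half is a Polygamma series, convergent for m >= 1.\<close>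

lemma cot_pfd_sums:
  assumes "0 < Re z" "Re z < 1" "m \<ge> 1"
  shows "(\<lambda>j. 1 / (z + of_nat j) ^ Suc m + (-1) ^ Suc m / (1 - z + of_nat j) ^ Suc m)
           sums cot_pfd m z"
proof -
  have m: "m > 0" and ne: "z \<noteq> 0" "1 - z \<noteq> 0"
    using assms by auto
  have "(\<lambda>j. inverse ((z + of_nat j) ^ Suc m) + (-1) ^ Suc m * inverse ((1 - z + of_nat j) ^ Suc m))
           sums ((-1) ^ Suc m * Polygamma m z / fact m +
             (-1) ^ Suc m * ((-1) ^ Suc m * Polygamma m (1 - z) / fact m))"
    by (intro sums_add sums_mult Polygamma_LIMSEQ m ne)
  then show ?thesis
    by (simp add: cot_pfd_def inverse_eq_divide field_simps)
qed

definition csc_pfd :: "nat \<Rightarrow> complex \<Rightarrow> complex" where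
  "csc_pfd m z = (cot_pfd m (z / 2) - cot_pfd m ((1 + z) / 2)) / 2 ^ Suc m"

lemma has_field_derivative_csc_pfd:
  assumes "0 < Re z" "Re z < 1"
  shows "(csc_pfd m has_field_derivative - of_nat (Suc m) * csc_pfd (Suc m) z) (at z)"
  unfolding csc_pfd_def using assms
  by (auto intro!: derivative_eq_intros DERIV_chain2[OF has_field_derivative_cot_pfd] simp: field_simps)

text \<open>With u = pi z / 2, the second cotangent is cot (u + pi/2) = -tan u, and (cot u + tan u)
  / 2 = 1 / sin (2u).\<close>

lemma csc_pfd_0:
  assumes "0 < Re z" "Re z < 1"
  shows "csc_pfd 0 z = of_real pi / sin (of_real pi * z)"
proof -
  define u where "u = of_real pi * (z / 2)"
  have s: "sin u \<noteq> 0"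
    unfolding u_def by (rule open_unit_strip_nonzero) (use assms in auto)
  have s': "sin (of_real pi * ((1 + z) / 2)) \<noteq> 0"
    by (rule open_unit_strip_nonzero) (use assms in auto)
  have e: "of_real pi * ((1 + z) / 2) = u + of_real pi / 2"
    by (simp add: u_def field_simps)
  have c: "cos u \<noteq> 0"
    using s' unfolding e by (simp add: sin_add)
  have "csc_pfd 0 z = (of_real pi * cos u / sin u + of_real pi * sin u / cos u) / 2"
    using assms unfolding csc_pfd_def by (simp add: cot_pfd_0 del: times_divide_eq_right)
        (simp only: e u_def[symmetric], simp add: sin_add cos_add)
  also have "\<dots> = of_real pi * ((sin u)\<^sup>2 + (cos u)\<^sup>2) / (2 * sin u * cos u)"
  proof -
    have "(p * c / s + p * s / c) / 2 = p * (s\<^sup>2 + c\<^sup>2) / (2 * s * c)" if "s \<noteq> 0" "c \<noteq> 0" for p s c :: complex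
      using that by (simp add: field_simps power2_eq_square)
    from this[OF s c] show ?thesis .
  qed
  also have "\<dots> = of_real pi / sin (2 * u)"
    by (simp only: sin_cos_squared_add sin_double mult_1_right)
  finally show ?thesis
    by (simp add: u_def)
qed

text \<open>Convergence of the grouped series alone would not suffice, hence the separate
  summability. Serves to interleave terms of even and odd index.\<close>

lemma sums_pairs:
  fixes f :: "nat \<Rightarrow> complex"
  assumes "summable f" "(\<lambda>j. f (2 * j) + f (2 * j + 1)) sums a"
  shows "f sums a"
proof -
  have "(\<lambda>n. \<Sum>i\<in>{n * 2..<n * 2 + 2}. f i) sums suminf f"
    using sums_group[OF summable_sums[OF assms(1)], of 2] by simp
  moreover have "(\<Sum>i\<in>{n * 2..<n * 2 + 2}. f i) = f (2 * n) + f (2 * n + 1)" for n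
    by (simp add: numeral_2_eq_2 mult.commute)
  ultimately have "suminf f = a"
    using assms(2) sums_unique2 by simp
  then show ?thesis
    using assms(1) by (metis summable_sums)
qed

lemma summable_inverse_power_shift:
  assumes "0 < Re z" "m \<ge> 1"
  shows "summable (\<lambda>j. norm (1 / (z + of_nat j) ^ Suc m))"
proof (rule summable_comparison_test)
  show "summable (\<lambda>j. inverse ((Re z + of_nat j) ^ Suc m))"
    using assms by (intro Polygamma_converges') auto
  have "norm (1 / (z + of_nat j) ^ Suc m) \<le> inverse ((Re z + of_nat j) ^ Suc m)" for j
  proof -
    have "Re z + of_nat j \<le> norm (z + of_nat j)"
      using complex_Re_le_cmod[of "z + of_nat j"] by simp
    then have "(Re z + of_nat j) ^ Suc m \<le> norm (z + of_nat j) ^ Suc m"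
      using assms by (intro power_mono) auto
    moreover have "0 < (Re z + of_nat j) ^ Suc m"
      using assms by (intro zero_less_power) auto
    ultimately show ?thesis
      unfolding norm_divide norm_power norm_one inverse_eq_divide
      by (intro frac_le) auto
  qed
  then show "\<exists>N. \<forall>j\<ge>N. norm (norm (1 / (z + of_nat j) ^ Suc m)) \<le> inverse ((Re z + of_nat j) ^ Suc m)"
    by auto
qed

text \<open>Even integers come from 2 (z/2 + j) = z + 2j and odd ones from 2 ((1 + z)/2 + j) = z +
  2j + 1, which also explains the divisor 2^(m+1) in \<open>csc_pfd\<close>. The integers j and -j-1
  have opposite parity; for odd m the sign (-1)^(m+1) is 1, so each pair is a difference.\<close>

lemma csc_pfd_sums:
  assumes "0 < Re z" "Re z < 1" "odd m"
  shows "(\<lambda>j. (-1) ^ j * (1 / (z + of_nat j) ^ Suc m - 1 / (1 - z + of_nat j) ^ Suc m))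
           sums csc_pfd m z" (is "?f sums _")
proof (rule sums_pairs)
  have m: "m \<ge> 1" using assms by (cases m) auto
  have s: "summable (\<lambda>j. norm (1 / (z + of_nat j) ^ Suc m) + norm (1 / (1 - z + of_nat j) ^ Suc m))"
    using assms m by (intro summable_add summable_inverse_power_shift) auto
  show "summable ?f"
    by (rule summable_comparison_test[OF _ s])
       (auto simp: norm_mult norm_power simp del: power_Suc intro!: order_trans[OF norm_triangle_ineq4])
  have h: "1 / (w / 2 + of_nat j) ^ Suc m = 2 ^ Suc m / (w + of_nat (2 * j)) ^ Suc m" for w :: complex and j
    by (simp add: add_divide_distrib[symmetric] power_divide field_simps flip: power_mult_distrib)
  have c: "(\<lambda>j. (1 / (w / 2 + of_nat j) ^ Suc m + 1 / ((2 - w) / 2 + of_nat j) ^ Suc m)) sums cot_pfd m (w / 2)"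
    if "0 < Re w" "Re w < 2" for w
    using cot_pfd_sums[of "w / 2" m] that m assms by (simp add: diff_divide_distrib)
  have "(\<lambda>j. (2 ^ Suc m / (z + of_nat (2 * j)) ^ Suc m + 2 ^ Suc m / (2 - z + of_nat (2 * j)) ^ Suc m -
         (2 ^ Suc m / (1 + z + of_nat (2 * j)) ^ Suc m + 2 ^ Suc m / (2 - (1 + z) + of_nat (2 * j)) ^ Suc m)) / 2 ^ Suc m)
     sums csc_pfd m z"
    unfolding csc_pfd_def
    by (intro sums_divide sums_diff c[unfolded h]) (use assms in auto)
  moreover have "1 + z + of_nat (2 * j) = z + of_nat (2 * j + 1)"
    "2 - z + of_nat (2 * j) = 1 - z + of_nat (2 * j + 1)"
    "2 - (1 + z) + of_nat (2 * j) = 1 - z + of_nat (2 * j)" for j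
    by simp_all
  moreover have "(2 ^ Suc m / a + 2 ^ Suc m / b - (2 ^ Suc m / c + 2 ^ Suc m / d)) / 2 ^ Suc m =
     1 / a + 1 / b - (1 / c + 1 / d)" for a b c d :: complex
    by (simp add: diff_divide_distrib add_divide_distrib)
  ultimately show "(\<lambda>j. ?f (2 * j) + ?f (2 * j + 1)) sums csc_pfd m z"
    by (simp only: power_add power_mult) (simp add: algebra_simps)
qed

subsection \<open>Integrals of single partial fractions and of their series\<close>

lemma norm_inverse_Complex_le:
  assumes "b > 0"
  shows "norm (inverse (Complex b (- x))) \<le> 1 / b"
proof -
  have "b \<le> norm (Complex b (- x))"
    using complex_Re_le_cmod[of "Complex b (- x)"] by simp
  then show ?thesis
    using assms by (simp add: norm_inverse inverse_eq_divide[symmetric] le_imp_inverse_le)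
qed

text \<open>The point is to keep one factor Im w: for w = 1 / (b - i x) it is of order x and
  compensates the division by x.\<close>

lemma abs_Im_power_le: "\<bar>Im (w ^ m)\<bar> \<le> of_nat m * \<bar>Im w\<bar> * norm w ^ (m - 1)"
proof (induction m)
  case (Suc m)
  have "\<bar>Im (w ^ Suc m)\<bar> \<le> \<bar>Re w * Im (w ^ m)\<bar> + \<bar>Im w * Re (w ^ m)\<bar>"
    by simp
  also have "\<bar>Re w * Im (w ^ m)\<bar> \<le> norm w * (of_nat m * \<bar>Im w\<bar> * norm w ^ (m - 1))"
    unfolding abs_mult by (intro mult_mono Suc.IH abs_Re_le_cmod) auto
  also have "\<bar>Im w * Re (w ^ m)\<bar> \<le> \<bar>Im w\<bar> * norm w ^ m"
    unfolding abs_mult by (intro mult_left_mono order_trans[OF abs_Re_le_cmod]) (auto simp: norm_power)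
  also have "norm w * (of_nat m * \<bar>Im w\<bar> * norm w ^ (m - 1)) + \<bar>Im w\<bar> * norm w ^ m
      = of_nat (Suc m) * \<bar>Im w\<bar> * norm w ^ (Suc m - 1)"
    by (cases m) (auto simp: algebra_simps)
  finally show ?case by simp
qed auto

lemma Im_inverse_Complex: "Im (inverse (Complex b (- x))) = x / (b\<^sup>2 + x\<^sup>2)"
  by simp

text \<open>The majorant for all integrability and interchange arguments: integrable in x, with an
  integral of order b^(-M).\<close>

lemma abs_Im_inverse_power_div_le:
  assumes "b > 0" "x > 0" "M \<ge> 1"
  shows "\<bar>Im (inverse (Complex b (- x)) ^ M) / x\<bar> \<le> of_nat M / b ^ (M - 1) * (1 / (b\<^sup>2 + x\<^sup>2))"
proof -
  let ?w = "inverse (Complex b (- x))"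
  have "\<bar>Im (?w ^ M)\<bar> \<le> of_nat M * \<bar>Im ?w\<bar> * norm ?w ^ (M - 1)"
    by (rule abs_Im_power_le)
  also have "\<dots> \<le> of_nat M * \<bar>Im ?w\<bar> * (1 / b) ^ (M - 1)"
    by (intro mult_left_mono power_mono norm_inverse_Complex_le) (use assms in auto)
  also have "\<bar>Im ?w\<bar> = x / (b\<^sup>2 + x\<^sup>2)"
    unfolding Im_inverse_Complex using assms by simp
  finally show ?thesis
    using assms by (simp add: field_simps power_divide)
qed

lemma isCont_inverse_Complex_power:
  assumes "b > 0"
  shows "isCont (\<lambda>x. Im (inverse (Complex b (- x)) ^ M)) x"
proof -
  have "Complex b (- x) \<noteq> 0" for x
    using assms by (auto simp: complex_eq_iff)
  moreover have "isCont (\<lambda>x. Complex b (- x)) x"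
    unfolding Complex_eq by (intro continuous_intros)
  ultimately show ?thesis
    by (intro isCont_Im isCont_power) (auto intro!: continuous_intros)
qed

lemma has_real_derivative_Im_inverse_Complex_power:
  assumes "b > 0"
  shows "((\<lambda>x. Im (inverse (Complex b (- x)) ^ M)) has_real_derivative
            of_nat M * Re (inverse (Complex b (- x)) ^ Suc M)) (at x)"
proof -
  have nz: "Complex b (- x) \<noteq> 0"
    using assms by (auto simp: complex_eq_iff)
  let ?w = "inverse (of_real b - \<i> * of_real x)"
  have "of_real b - \<i> * of_real x \<noteq> 0"
    using nz by (simp add: Complex_eq)
  then have "((\<lambda>z. inverse (of_real b - \<i> * z)) has_field_derivative \<i> * ?w\<^sup>2) (at (of_real x))"
    by (auto intro!: derivative_eq_intros simp: power2_eq_square)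
  then have "((\<lambda>z. inverse (of_real b - \<i> * z) ^ M) has_field_derivative
               of_nat M * (\<i> * ?w\<^sup>2 * ?w ^ (M - Suc 0))) (at (of_real x))"
    by (rule DERIV_power)
  moreover have "of_nat M * (\<i> * ?w\<^sup>2 * ?w ^ (M - Suc 0)) = of_nat M * \<i> * ?w ^ Suc M"
    by (cases M) (simp_all add: power2_eq_square mult_ac)
  ultimately have "((\<lambda>z. inverse (of_real b - \<i> * z) ^ M) has_field_derivative
               of_nat M * \<i> * ?w ^ Suc M) (at (of_real x))"
    by simp
  then have "((\<lambda>x. inverse (of_real b - \<i> * of_real x) ^ M) has_vector_derivative
            of_nat M * \<i> * inverse (of_real b - \<i> * of_real x) ^ Suc M) (at x)"
    by (rule has_vector_derivative_real_field)
  then have "((\<lambda>x. Im (inverse (of_real b - \<i> * of_real x) ^ M)) has_vector_derivative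
            Im (of_nat M * \<i> * inverse (of_real b - \<i> * of_real x) ^ Suc M)) (at x)"
    by (rule bounded_linear.has_vector_derivative[OF bounded_linear_Im])
  moreover have "of_real b - \<i> * of_real x = Complex b (- x)" for x
    by (simp add: Complex_eq)
  moreover have "Im (of_nat M * \<i> * w) = of_nat M * Re w" for w
    by simp
  ultimately show ?thesis
    by (simp only: has_real_derivative_iff_has_vector_derivative)
qed

lemma tendsto_Im_inverse_Complex_power:
  assumes "b > 0" "M \<ge> 1"
  shows "((\<lambda>x. Im (inverse (Complex b (- x)) ^ M)) \<longlongrightarrow> 0) at_top"
proof (rule Lim_null_comparison)
  show "eventually (\<lambda>x. norm (Im (inverse (Complex b (- x)) ^ M)) \<le> of_nat M / b ^ (M - 1) * (x / (b\<^sup>2 + x\<^sup>2))) at_top"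
    using eventually_gt_at_top[of 0]
  proof eventually_elim
    case (elim x)
    show ?case
      using abs_Im_inverse_power_div_le[OF assms(1) elim assms(2)] elim by (simp add: field_simps)
  qed
  have "((\<lambda>x. x / (b\<^sup>2 + x\<^sup>2)) \<longlongrightarrow> 0) at_top"
    using assms by real_asymp
  then show "((\<lambda>x. of_nat M / b ^ (M - 1) * (x / (b\<^sup>2 + x\<^sup>2))) \<longlongrightarrow> 0) at_top"
    by (rule tendsto_mult_right_zero)
qed

text \<open>With w = 1 / (b - i x), imaginary parts of w^(M+1) = (b - i x) w^(M+2) give Im w^(M+2) /
  x = (Im w^(M+1) / x + Re w^(M+2)) / b, and Re w^(M+2) is the derivative of Im w^(M+1) / (M+1).
  That boundary term vanishes at 0 and at infinity, so each induction step only divides the limit by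
  b. The start is an arctangent, as Im w / x = 1 / (b^2 + x^2). At 0 only continuity is asked, since
  there the quotient has the default value 0.\<close>

lemma antiderivative_Im_inverse_Complex_power:
  assumes b: "b > 0"
  shows "\<exists>F. (\<forall>x>0. (F has_real_derivative Im (inverse (Complex b (- x)) ^ Suc M) / x) (at x)) \<and>
             F 0 = 0 \<and> isCont F 0 \<and> (F \<longlongrightarrow> pi / 2 / b ^ Suc M) at_top"
proof (induction M)
  case 0
  show ?case
  proof (intro exI[of _ "\<lambda>x. arctan (x / b) / b"] conjI allI impI)
    fix x :: real assume "x > 0"
    then show "((\<lambda>x. arctan (x / b) / b) has_real_derivative Im (inverse (Complex b (- x)) ^ Suc 0) / x) (at x)"
      using b unfolding power_Suc0_right Im_inverse_Complex by (auto intro!: derivative_eq_intros simp: field_simps power2_eq_square add_nonneg_eq_0_iff)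
  next
    show "((\<lambda>x. arctan (x / b) / b) \<longlongrightarrow> pi / 2 / b ^ Suc 0) at_top"
      using b by real_asymp (simp add: field_simps)
  qed (use b in \<open>auto intro!: continuous_intros\<close>)
next
  case (Suc M)
  then obtain F where F: "\<And>x. x > 0 \<Longrightarrow> (F has_real_derivative Im (inverse (Complex b (- x)) ^ Suc M) / x) (at x)"
    "F 0 = 0" "isCont F 0" "(F \<longlongrightarrow> pi / 2 / b ^ Suc M) at_top"
    by auto
  let ?w = "\<lambda>x. inverse (Complex b (- x))"
  let ?G = "\<lambda>x. (F x + Im (?w x ^ Suc M) / of_nat (Suc M)) / b"
  show ?case
  proof (intro exI[of _ ?G] conjI allI impI)
    fix x :: real assume x: "x > 0"
    have "(?G has_real_derivative (Im (?w x ^ Suc M) / x + of_nat (Suc M) * Re (?w x ^ Suc (Suc M)) / of_nat (Suc M)) / b) (at x)"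
      by (intro DERIV_cdivide DERIV_add F(1)[OF x] has_real_derivative_Im_inverse_Complex_power b)
    moreover have "(Im (?w x ^ Suc M) / x + of_nat (Suc M) * Re (?w x ^ Suc (Suc M)) / of_nat (Suc M)) / b
        = Im (?w x ^ Suc (Suc M)) / x"
    proof -
      have "Complex b (- x) \<noteq> 0"
        using b by (auto simp: complex_eq_iff)
      then have "?w x ^ Suc M = Complex b (- x) * ?w x ^ Suc (Suc M)"
        by simp
      also have "Im \<dots> = b * Im (?w x ^ Suc (Suc M)) - x * Re (?w x ^ Suc (Suc M))"
        by (simp only: times_complex.sel complex.sel)
      finally have "Im (?w x ^ Suc M) = b * Im (?w x ^ Suc (Suc M)) - x * Re (?w x ^ Suc (Suc M))" .
      then show ?thesis
        using b x by (simp add: field_simps del: power_Suc of_nat_Suc)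
    qed
    ultimately show "(?G has_real_derivative Im (?w x ^ Suc (Suc M)) / x) (at x)"
      by simp
  next
    have "Complex b (- 0) = of_real b"
      by (simp add: complex_eq_iff)
    then have "inverse (Complex b (- 0)) = of_real (inverse b)"
      by (simp only: of_real_inverse)
    then have "Im (?w 0 ^ Suc M) = 0"
      by (simp del: power_Suc flip: of_real_power)
    then show "?G 0 = 0"
      using F(2) by simp
  next
    show "isCont ?G 0"
      by (intro continuous_intros F(3) isCont_inverse_Complex_power b) (use b in auto)
  next
    have "(?G \<longlongrightarrow> (pi / 2 / b ^ Suc M + 0 / of_nat (Suc M)) / b) at_top"
      by (intro tendsto_intros F(4) tendsto_Im_inverse_Complex_power) (use b in auto)
    then show "(?G \<longlongrightarrow> pi / 2 / b ^ Suc (Suc M)) at_top"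
      by (simp add: field_simps)
  qed
qed

text \<open>For a nonnegative integrand the fundamental theorem yields integrability together with
  the value.\<close>

lemma set_integral_inverse_square_plus:
  assumes b: "b > 0"
  shows "set_integrable lborel {0<..} (\<lambda>x. 1 / (b\<^sup>2 + x\<^sup>2))" (is ?I)
    and "(LINT x:{0<..}|lborel. 1 / (b\<^sup>2 + x\<^sup>2)) = pi / 2 / b" (is ?J)
proof -
  have e: "einterval 0 \<infinity> = {0<..}"
    by (auto simp: einterval_def)
  let ?F = "\<lambda>x. arctan (x / b) / b"
  have A: "((?F \<circ> real_of_ereal) \<longlongrightarrow> 0) (at_right 0)"
  proof -
    have "isCont ?F 0" using b by (intro continuous_intros) auto
    then have "(?F \<longlongrightarrow> 0) (at_right 0)"
      unfolding isCont_def by (simp add: filterlim_at_split)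
    then show ?thesis
      unfolding zero_ereal_def ereal_tendsto_simps .
  qed
  have B: "((?F \<circ> real_of_ereal) \<longlongrightarrow> pi / 2 / b) (at_left \<infinity>)"
    unfolding ereal_tendsto_simps using b by real_asymp (simp add: field_simps)
  have F: "DERIV ?F x :> 1 / (b\<^sup>2 + x\<^sup>2)" for x
    using b by (auto intro!: derivative_eq_intros simp: field_simps power2_eq_square add_nonneg_eq_0_iff)
  have c: "isCont (\<lambda>x. 1 / (b\<^sup>2 + x\<^sup>2)) x" for x
    using b by (intro continuous_intros) (auto simp: add_nonneg_eq_0_iff)
  have n: "AE x in lborel. 0 < ereal x \<longrightarrow> ereal x < \<infinity> \<longrightarrow> 0 \<le> 1 / (b\<^sup>2 + x\<^sup>2)"
    by auto
  have *: "(0::ereal) < \<infinity>" by simp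
  show ?I
    using interval_integral_FTC_nonneg(1)[OF * F c n A B] by (simp add: e)
  show ?J
    using interval_integral_FTC_nonneg(2)[OF * F c n A B]
    by (simp add: interval_lebesgue_integral_0_infty field_simps)
qed

text \<open>This integrand may change sign, so integrability is first taken from the majorant; then
  the antiderivative gives the value.\<close>

lemma set_integral_Im_inverse_Complex_power:
  assumes b: "b > 0"
  shows "set_integrable lborel {0<..} (\<lambda>x. Im (inverse (Complex b (- x)) ^ Suc M) / x)" (is "set_integrable _ _ ?f")
    and "(LINT x:{0<..}|lborel. Im (inverse (Complex b (- x)) ^ Suc M) / x) = pi / 2 / b ^ Suc M" (is ?J)
proof -
  have e: "einterval 0 \<infinity> = {0<..}"
    by (auto simp: einterval_def)
  have c: "isCont ?f x" if "x > 0" for x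
    using that by (intro continuous_intros isCont_inverse_Complex_power b) auto
  show I: "set_integrable lborel {0<..} ?f"
  proof (rule set_integrable_bound)
    show "set_integrable lborel {0<..} (\<lambda>x. of_nat (Suc M) / b ^ (Suc M - 1) * (1 / (b\<^sup>2 + x\<^sup>2)))"
      by (intro set_integrable_mult_right set_integral_inverse_square_plus(1) b)
    show "set_borel_measurable lborel {0<..} ?f"
      unfolding set_borel_measurable_def
      using borel_measurable_continuous_on_indicator[of "{0<..}" ?f] c
      by (auto simp: continuous_on_eq_continuous_at)
    have "norm (?f x) \<le> norm (of_nat (Suc M) / b ^ (Suc M - 1) * (1 / (b\<^sup>2 + x\<^sup>2)))" if "x > 0" for x
      using abs_Im_inverse_power_div_le[OF b that, of "Suc M"] unfolding real_norm_def
      by (intro order_trans[OF _ abs_ge_self]) simp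
    then show "AE x in lborel. x \<in> {0<..} \<longrightarrow> norm (?f x) \<le> norm (of_nat (Suc M) / b ^ (Suc M - 1) * (1 / (b\<^sup>2 + x\<^sup>2)))"
      by auto
  qed
  obtain F where F: "\<And>x. x > 0 \<Longrightarrow> (F has_real_derivative ?f x) (at x)"
    "F 0 = 0" "isCont F 0" "(F \<longlongrightarrow> pi / 2 / b ^ Suc M) at_top"
    using antiderivative_Im_inverse_Complex_power[OF b, of M] by auto
  have "(LBINT x=0..\<infinity>. ?f x) = pi / 2 / b ^ Suc M - 0"
  proof (rule interval_integral_FTC_integrable)
    have "(F \<longlongrightarrow> 0) (at_right 0)"
      using F(2,3) unfolding isCont_def by (simp add: filterlim_at_split)
    then show "((F \<circ> real_of_ereal) \<longlongrightarrow> 0) (at_right 0)"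
      unfolding zero_ereal_def ereal_tendsto_simps .
    show "((F \<circ> real_of_ereal) \<longlongrightarrow> pi / 2 / b ^ Suc M) (at_left \<infinity>)"
      unfolding ereal_tendsto_simps by (rule F(4))
    show "set_integrable lborel (einterval 0 \<infinity>) ?f"
      unfolding e by (rule I)
  qed (use F(1) c in \<open>auto simp: has_real_derivative_iff_has_vector_derivative\<close>)
  then show ?J
    by (simp add: interval_lebesgue_integral_0_infty)
qed

text \<open>Interchange of sum and integral, which requires absolute summability at each point and
  summability of the L1 norms. Both reduce to the sum of 1 / b_j^(M+1).\<close>

lemma has_integral_sums_Im_inverse_Complex_power:
  fixes b :: "nat \<Rightarrow> real" and c :: "nat \<Rightarrow> real"
  assumes b: "\<And>j. b j > 0" and c: "\<And>j. \<bar>c j\<bar> \<le> 1"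
    and s: "summable (\<lambda>j. 1 / b j ^ Suc M)" and M: "M \<ge> 1"
    and f: "\<And>x. x > 0 \<Longrightarrow> (\<lambda>j. c j * Im (inverse (Complex (b j) (- x)) ^ Suc M)) sums f x"
  shows "((\<lambda>x. f x / x) has_integral pi / 2 * (\<Sum>j. c j / b j ^ Suc M)) {0<..}"
proof -
  define g where "g j x = c j * (Im (inverse (Complex (b j) (- x)) ^ Suc M) / x)" for j x
  define h where "h j x = indicator {0<..} x *\<^sub>R g j x" for j and x :: real
  have gi: "set_integrable lborel {0<..} (g j)" for j
    unfolding g_def by (intro set_integrable_mult_right set_integral_Im_inverse_Complex_power b)
  then have hi: "integrable lborel (h j)" for j
    unfolding h_def set_integrable_def .
  have hI: "integral\<^sup>L lborel (h j) = pi / 2 * (c j / b j ^ Suc M)" for j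
    using set_integral_Im_inverse_Complex_power(2)[OF b[of j], of M]
    unfolding h_def g_def set_lebesgue_integral_def[symmetric] set_integral_mult_right by simp
  have bound: "norm (g j x) \<le> of_nat (Suc M) / b j ^ M * (1 / ((b j)\<^sup>2 + x\<^sup>2))" if "x > 0" for j x
  proof -
    have "norm (g j x) \<le> 1 * \<bar>Im (inverse (Complex (b j) (- x)) ^ Suc M) / x\<bar>"
      unfolding g_def norm_mult real_norm_def abs_mult by (intro mult_right_mono c) auto
    also have "\<dots> \<le> of_nat (Suc M) / b j ^ M * (1 / ((b j)\<^sup>2 + x\<^sup>2))"
      using abs_Im_inverse_power_div_le[OF b that, of "Suc M" j] by simp
    finally show ?thesis .
  qed
  have *: "(\<lambda>j. integral\<^sup>L lborel (h j)) sums (\<integral>x. (\<Sum>j. h j x) \<partial>lborel)" "integrable lborel (\<lambda>x. \<Sum>j. h j x)"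
  proof -
    have sx: "summable (\<lambda>j. norm (h j x))" for x
    proof (cases "x > 0")
      case True
      show ?thesis
      proof (rule summable_comparison_test)
        show "summable (\<lambda>j. of_nat (Suc M) / x * (1 / b j ^ Suc M))"
          by (intro summable_mult s)
        \<comment> \<open>For fixed x > 0, b x \<le> b^2 + x^2 trades the quadratic denominator for
          the missing factor 1 / b_j, at the cost of a constant depending on x.\<close>
        have "norm (g j x) \<le> of_nat (Suc M) / x * (1 / b j ^ Suc M)" for j
        proof -
          have "b j * x \<le> (b j)\<^sup>2 + x\<^sup>2"
            using sum_squares_bound[of "b j" x] mult_pos_pos[OF b[of j] True] by linarith
          then have "1 / ((b j)\<^sup>2 + x\<^sup>2) \<le> 1 / (b j * x)"
            using b[of j] True by (intro divide_left_mono mult_pos_pos) (auto intro!: add_pos_pos)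
          then have "of_nat (Suc M) / b j ^ M * (1 / ((b j)\<^sup>2 + x\<^sup>2)) \<le> of_nat (Suc M) / b j ^ M * (1 / (b j * x))"
            using b[of j] by (intro mult_left_mono) auto
          with bound[OF True, of j] show ?thesis
            by (simp add: field_simps)
        qed
        then show "\<exists>N. \<forall>j\<ge>N. norm (norm (h j x)) \<le> of_nat (Suc M) / x * (1 / b j ^ Suc M)"
          using True by (auto simp: h_def)
      qed
    qed (simp add: h_def)
    \<comment> \<open>Here a bound uniform in x is needed: the majorant is integrated exactly, and
      pi / (2 b_j) supplies the missing factor 1 / b_j.\<close>
    have si: "summable (\<lambda>j. \<integral>x. norm (h j x) \<partial>lborel)"
    proof (rule summable_comparison_test)
      show "summable (\<lambda>j. of_nat (Suc M) * (pi / 2) * (1 / b j ^ Suc M))"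
        by (intro summable_mult s)
      have "(\<integral>x. norm (h j x) \<partial>lborel) \<le> of_nat (Suc M) * (pi / 2) * (1 / b j ^ Suc M)" for j
      proof -
        have "(\<integral>x. norm (h j x) \<partial>lborel) \<le>
            (\<integral>x. indicator {0<..} x *\<^sub>R (of_nat (Suc M) / b j ^ M * (1 / ((b j)\<^sup>2 + x\<^sup>2))) \<partial>lborel)"
        proof (rule integral_mono)
          show "integrable lborel (\<lambda>x. indicator {0<..} x *\<^sub>R (of_nat (Suc M) / b j ^ M * (1 / ((b j)\<^sup>2 + x\<^sup>2))))"
            unfolding set_integrable_def[symmetric]
            by (intro set_integrable_mult_right set_integral_inverse_square_plus(1) b)
          show "norm (h j x) \<le> indicator {0<..} x *\<^sub>R (of_nat (Suc M) / b j ^ M * (1 / ((b j)\<^sup>2 + x\<^sup>2)))" for x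
            using bound[of x j] by (auto simp: h_def indicator_def)
        qed (intro integrable_norm hi)
        also have "\<dots> = of_nat (Suc M) / b j ^ M * (pi / 2 / b j)"
          unfolding set_lebesgue_integral_def[symmetric] set_integral_mult_right
            set_integral_inverse_square_plus(2)[OF b] ..
        finally show ?thesis
          by (simp add: field_simps)
      qed
      then show "\<exists>N. \<forall>j\<ge>N. norm (\<integral>x. norm (h j x) \<partial>lborel) \<le> of_nat (Suc M) * (pi / 2) * (1 / b j ^ Suc M)"
        by auto
    qed
    show "(\<lambda>j. integral\<^sup>L lborel (h j)) sums (\<integral>x. (\<Sum>j. h j x) \<partial>lborel)" "integrable lborel (\<lambda>x. \<Sum>j. h j x)"
      by (rule sums_integral integrable_suminf; use hi sx si in auto)+
  qed
  have hs: "(\<Sum>j. h j x) = (if x \<in> {0<..} then f x / x else 0)" for x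
  proof (cases "x > 0")
    case True
    then show ?thesis
      using sums_divide[OF f[OF True], of x] by (simp add: h_def g_def sums_iff)
  qed (simp add: h_def)
  have "pi / 2 * (\<Sum>j. c j / b j ^ Suc M) = (\<integral>x. (\<Sum>j. h j x) \<partial>lborel)"
  proof -
    have "(\<lambda>j. pi / 2 * (c j / b j ^ Suc M)) sums (\<integral>x. (\<Sum>j. h j x) \<partial>lborel)"
      using *(1) unfolding hI .
    then have "(\<lambda>j. 2 / pi * (pi / 2 * (c j / b j ^ Suc M))) sums (2 / pi * (\<integral>x. (\<Sum>j. h j x) \<partial>lborel))"
      by (rule sums_mult)
    then show ?thesis
      by (simp add: sums_iff)
  qed
  then have "((\<lambda>x. \<Sum>j. h j x) has_integral pi / 2 * (\<Sum>j. c j / b j ^ Suc M)) UNIV"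
    using has_integral_integral_lborel[OF *(2)] by simp
  then show ?thesis
    unfolding hs by (subst (asm) has_integral_restrict_UNIV)
qed

subsection \<open>Partial fractions of hyperbolic quotients\<close>

definition trig_pfd :: "nat \<Rightarrow> nat \<Rightarrow> complex \<Rightarrow> complex" where
  "trig_pfd s = (if even s then cot_pfd else csc_pfd)"

lemma has_field_derivative_trig_pfd:
  assumes "0 < Re z" "Re z < 1"
  shows "(trig_pfd s m has_field_derivative - of_nat (Suc m) * trig_pfd s (Suc m) z) (at z)"
  using has_field_derivative_cot_pfd[OF assms] has_field_derivative_csc_pfd[OF assms]
  by (simp add: trig_pfd_def)

lemma open_strip: "open {z :: complex. 0 < Re z \<and> Re z < 1}"
  by (intro open_Collect_conj open_Collect_less continuous_intros)

text \<open>After one differentiation cos^2 = 1 - sin^2 leaves only powers of 1/sin, so the second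
  returns to the form cos / sin^(n+1). The factors (s+1)(s+2) and s^2 are those of
  \<open>arcsin_coeff_rec\<close>, which is why the expansion has these coefficients.\<close>

lemma cos_sin_power_derivative:
  assumes "0 < Re z" "Re z < 1"
  shows "((\<lambda>z. cos (of_real pi * z) / sin (of_real pi * z) ^ Suc s) has_field_derivative
           of_real pi * (of_nat s / sin (of_real pi * z) ^ s - of_nat (Suc s) / sin (of_real pi * z) ^ (s + 2))) (at z)"
    and "((\<lambda>z. of_real pi * (of_nat s / sin (of_real pi * z) ^ s - of_nat (Suc s) / sin (of_real pi * z) ^ (s + 2)))
           has_field_derivative
           of_real pi ^ 2 * (of_nat ((s + 1) * (s + 2)) * (cos (of_real pi * z) / sin (of_real pi * z) ^ Suc (s + 2))
             - of_nat (s\<^sup>2) * (cos (of_real pi * z) / sin (of_real pi * z) ^ Suc s))) (at z)"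
proof -
  let ?u = "of_real pi * z"
  have nz: "sin ?u \<noteq> 0"
    using assms by (rule open_unit_strip_nonzero)
  have pw: "((\<lambda>z. 1 / sin (of_real pi * z) ^ n) has_field_derivative
          - of_nat n * of_real pi * (cos ?u / sin ?u ^ Suc n)) (at z)" for n
  proof -
    have "((\<lambda>z. inverse (sin (of_real pi * z))) has_field_derivative
          - (cos ?u * of_real pi) * inverse (sin ?u) ^ 2) (at z)"
      using nz by (auto intro!: derivative_eq_intros simp: power2_eq_square)
    then have "((\<lambda>z. inverse (sin (of_real pi * z)) ^ n) has_field_derivative
        of_nat n * (- (cos ?u * of_real pi) * inverse (sin ?u) ^ 2 * inverse (sin ?u) ^ (n - Suc 0))) (at z)"
      by (rule DERIV_power)
    moreover have "of_nat n * (- (cos ?u * of_real pi) * inverse (sin ?u) ^ 2 * inverse (sin ?u) ^ (n - Suc 0))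
        = - of_nat n * of_real pi * (cos ?u / sin ?u ^ Suc n)"
      using nz by (cases n) (simp_all add: power2_eq_square field_simps)
    ultimately show ?thesis
      by (simp only: power_inverse divide_inverse mult_1_left)
  qed
  have c: "((\<lambda>z. cos (of_real pi * z)) has_field_derivative - sin ?u * of_real pi) (at z)"
    by (auto intro!: derivative_eq_intros)
  have c2: "cos ?u * cos ?u = 1 - sin ?u * sin ?u"
    using sin_cos_squared_add2[of ?u] by (simp add: algebra_simps power2_eq_square)
  have "((\<lambda>z. cos (of_real pi * z) * (1 / sin (of_real pi * z) ^ Suc s)) has_field_derivative
      - sin ?u * of_real pi * (1 / sin ?u ^ Suc s) +
      - of_nat (Suc s) * of_real pi * (cos ?u / sin ?u ^ Suc (Suc s)) * cos ?u) (at z)"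
    by (rule DERIV_mult[OF c pw])
  moreover have "- v * p * (1 / v ^ Suc s) + - of_nat (Suc s) * p * (c / v ^ Suc (Suc s)) * c =
      p * (of_nat s / v ^ s - of_nat (Suc s) / v ^ (s + 2))"
    if "v \<noteq> 0" "c * c = 1 - v * v" for v c p :: complex
  proof -
    define q where "q = v ^ s"
    have q: "q \<noteq> 0" using that by (simp add: q_def)
    have "- v * p * (1 / (v * q)) + - of_nat (Suc s) * p * (c / (v * (v * q))) * c =
        p * (- (v * v) - of_nat (Suc s) * (c * c)) / (v * v * q)"
      using q that(1) by (simp add: divide_simps) (simp add: algebra_simps)
    also have "\<dots> = p * (of_nat s / q - of_nat (Suc s) / (v * v * q))"
      unfolding that(2) using q that(1) by (simp add: divide_simps) (simp add: algebra_simps)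
    finally show ?thesis
      by (simp only: q_def power_Suc add_2_eq_Suc' mult.assoc)
  qed
  note this[OF nz c2]
  ultimately show "((\<lambda>z. cos (of_real pi * z) / sin (of_real pi * z) ^ Suc s) has_field_derivative
           of_real pi * (of_nat s / sin ?u ^ s - of_nat (Suc s) / sin ?u ^ (s + 2))) (at z)"
    by (simp only: times_divide_eq_right mult_1_right)
  have "((\<lambda>z. of_real pi * (of_nat s * (1 / sin (of_real pi * z) ^ s) - of_nat (Suc s) * (1 / sin (of_real pi * z) ^ (s + 2))))
           has_field_derivative of_real pi *
             (of_nat s * (- of_nat s * of_real pi * (cos ?u / sin ?u ^ Suc s)) -
              of_nat (Suc s) * (- of_nat (s + 2) * of_real pi * (cos ?u / sin ?u ^ Suc (s + 2))))) (at z)"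
    by (intro DERIV_cmult DERIV_diff pw)
  moreover have eq: "of_real pi *
             (of_nat s * (- of_nat s * of_real pi * a) - of_nat (Suc s) * (- of_nat (s + 2) * of_real pi * b))
     = of_real pi ^ 2 * (of_nat ((s + 1) * (s + 2)) * b - of_nat (s\<^sup>2) * a)" for a b :: complex
    by (simp add: algebra_simps power2_eq_square)
  ultimately show "((\<lambda>z. of_real pi * (of_nat s / sin (of_real pi * z) ^ s - of_nat (Suc s) / sin (of_real pi * z) ^ (s + 2)))
           has_field_derivative
           of_real pi ^ 2 * (of_nat ((s + 1) * (s + 2)) * (cos ?u / sin ?u ^ Suc (s + 2))
             - of_nat (s\<^sup>2) * (cos ?u / sin ?u ^ Suc s))) (at z)"
    by (simp only: eq) (simp only: times_divide_eq_right mult_1_right)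
qed

lemma second_derivatives_eq:
  fixes f g f' g' f'' g'' :: "complex \<Rightarrow> complex"
  assumes S: "open S" and eq: "\<And>z. z \<in> S \<Longrightarrow> f z = g z"
    and f: "\<And>z. z \<in> S \<Longrightarrow> (f has_field_derivative f' z) (at z)"
           "\<And>z. z \<in> S \<Longrightarrow> (f' has_field_derivative f'' z) (at z)"
    and g: "\<And>z. z \<in> S \<Longrightarrow> (g has_field_derivative g' z) (at z)"
           "\<And>z. z \<in> S \<Longrightarrow> (g' has_field_derivative g'' z) (at z)"
    and z: "z \<in> S"
  shows "f'' z = g'' z"
proof -
  have 1: "f' w = g' w" if w: "w \<in> S" for w
    using has_field_derivative_transform_within_open[OF f(1)[OF w] S w eq] g(1)[OF w] DERIV_unique by blast
  show ?thesis
    using has_field_derivative_transform_within_open[OF f(2)[OF z] S z 1] g(2)[OF z] DERIV_unique by blast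
qed

lemma cos_sin_power_expansion:
  assumes "0 < Re z" "Re z < 1"
  shows "cos (of_real pi * z) / sin (of_real pi * z) ^ Suc s =
           (\<Sum>m\<le>s. arcsin_coeff 0 s m * (trig_pfd s m z / of_real pi ^ Suc m))"
  using assms
proof (induction s arbitrary: z rule: induct_nat_012)
  case 0
  then show ?case
    by (simp add: arcsin_coeff_0 trig_pfd_def cot_pfd_0)
next
  case 1
  have nz: "sin (of_real pi * z) \<noteq> 0"
    using 1 by (rule open_unit_strip_nonzero)
  \<comment> \<open>The case s = 1 is the derivative of the expansion of 1/sin: cos / sin^2 is its
    derivative up to a constant.\<close>
  have "((\<lambda>w. of_real pi / sin (of_real pi * w)) has_field_derivative
           - of_nat (Suc 0) * csc_pfd (Suc 0) z) (at z)"
    by (rule has_field_derivative_transform_within_open[OF has_field_derivative_csc_pfd[OF 1] open_strip])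
       (use 1 csc_pfd_0 in auto)
  moreover have "((\<lambda>w. of_real pi / sin (of_real pi * w)) has_field_derivative
           - (of_real pi ^ 2 * cos (of_real pi * z) / sin (of_real pi * z) ^ 2)) (at z)"
    using nz by (auto intro!: derivative_eq_intros simp: power2_eq_square)
  ultimately have "csc_pfd (Suc 0) z = of_real pi ^ 2 * cos (of_real pi * z) / sin (of_real pi * z) ^ 2"
    using DERIV_unique by fastforce
  then show ?case
    using arcsin_coeff_1 by (simp add: trig_pfd_def power2_eq_square)
next
  case (ge2 s)
  let ?S = "{z :: complex. 0 < Re z \<and> Re z < 1}"
  define a where "a = arcsin_coeff 0"
  define p where "p = complex_of_real pi"
  define C where "C s z = cos (p * z) / sin (p * z) ^ Suc s" for s z
  define T where "T m = trig_pfd s m" for m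
  have dT: "(T m has_field_derivative - of_nat (Suc m) * T (Suc m) z) (at z)" if "z \<in> ?S" for m z
    using that has_field_derivative_trig_pfd[of z s m] by (simp add: T_def)
  have p: "p \<noteq> 0" by (simp add: p_def)
  \<comment> \<open>The induction hypothesis holds on the whole open strip, so it may be
    differentiated twice; \<open>trig_pfd\<close> then moves from m to m + 2.\<close>
  have "p ^ 2 * (of_nat ((s + 1) * (s + 2)) * C (s + 2) z - of_nat (s\<^sup>2) * C s z) =
      (\<Sum>m\<le>s. a s m * ((- of_nat (Suc m) * (- of_nat (Suc (Suc m)) * T (Suc (Suc m)) z)) / p ^ Suc m))"
  proof (rule second_derivatives_eq[OF open_strip, where f = "C s"
        and f' = "\<lambda>w. p * (of_nat s / sin (p * w) ^ s - of_nat (Suc s) / sin (p * w) ^ (s + 2))"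
        and f'' = "\<lambda>w. p ^ 2 * (of_nat ((s + 1) * (s + 2)) * C (s + 2) w - of_nat (s\<^sup>2) * C s w)"
        and g = "\<lambda>w. \<Sum>m\<le>s. a s m * (T m w / p ^ Suc m)"
        and g' = "\<lambda>w. \<Sum>m\<le>s. a s m * ((- of_nat (Suc m) * T (Suc m) w) / p ^ Suc m)"])
    fix w assume w: "w \<in> ?S"
    show "C s w = (\<Sum>m\<le>s. a s m * (T m w / p ^ Suc m))"
      using ge2.IH(1)[of w] w by (simp add: a_def p_def C_def T_def)
    show "(C s has_field_derivative p * (of_nat s / sin (p * w) ^ s - of_nat (Suc s) / sin (p * w) ^ (s + 2))) (at w)"
      unfolding C_def p_def using w by (intro cos_sin_power_derivative(1)) auto
    show "((\<lambda>w. p * (of_nat s / sin (p * w) ^ s - of_nat (Suc s) / sin (p * w) ^ (s + 2))) has_field_derivative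
         p ^ 2 * (of_nat ((s + 1) * (s + 2)) * C (s + 2) w - of_nat (s\<^sup>2) * C s w)) (at w)"
      unfolding C_def p_def using w by (intro cos_sin_power_derivative(2)) auto
    show "((\<lambda>w. \<Sum>m\<le>s. a s m * (T m w / p ^ Suc m)) has_field_derivative
        (\<Sum>m\<le>s. a s m * ((- of_nat (Suc m) * T (Suc m) w) / p ^ Suc m))) (at w)"
      by (intro DERIV_sum DERIV_cmult DERIV_cdivide dT w)
    show "((\<lambda>w. \<Sum>m\<le>s. a s m * ((- of_nat (Suc m) * T (Suc m) w) / p ^ Suc m)) has_field_derivative
        (\<Sum>m\<le>s. a s m * ((- of_nat (Suc m) * (- of_nat (Suc (Suc m)) * T (Suc (Suc m)) w)) / p ^ Suc m))) (at w)"
      by (intro DERIV_sum DERIV_cmult DERIV_cdivide dT w)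
  qed (use ge2.prems in auto)
  also have "\<dots> = p ^ 2 * (\<Sum>m\<le>s. of_nat ((m + 2) * (m + 1)) * a s m * (T (m + 2) z / p ^ Suc (m + 2)))"
    unfolding sum_distrib_left using p by (intro sum.cong) (auto simp: power2_eq_square field_simps)
  finally have C: "of_nat ((s + 1) * (s + 2)) * C (s + 2) z = of_nat (s\<^sup>2) * C s z +
      (\<Sum>m\<le>s. of_nat ((m + 2) * (m + 1)) * a s m * (T (m + 2) z / p ^ Suc (m + 2)))"
    using p by (simp only: mult_cancel_left diff_eq_eq zero_eq_power2) (simp only: add.commute simp_thms)
  \<comment> \<open>The index is shifted by two; the new terms m = 0 and m = 1 carry the factor m (m
    - 1) = 0.\<close>
  have "(\<Sum>m\<le>s. of_nat ((m + 2) * (m + 1)) * a s m * (T (m + 2) z / p ^ Suc (m + 2))) =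
      (\<Sum>m\<le>s + 2. of_nat (m * (m - 1)) * a s (m - 2) * (T m z / p ^ Suc m))"
    using sum.atMost_Suc_shift[of "\<lambda>m. of_nat (m * (m - 1)) * a s (m - 2) * (T m z / p ^ Suc m)" "Suc s"]
      sum.atMost_Suc_shift[of "\<lambda>m. of_nat (Suc m * m) * a s (Suc m - 2) * (T (Suc m) z / p ^ Suc (Suc m))" s]
    by (simp add: mult_ac)
  moreover have "C s z = (\<Sum>m\<le>s. a s m * (T m z / p ^ Suc m))"
    using ge2 by (simp add: a_def p_def C_def T_def)
  then have "C s z = (\<Sum>m\<le>s + 2. a s m * (T m z / p ^ Suc m))"
    by (simp add: a_def arcsin_coeff_eq_0_if_less)
  ultimately have "of_nat ((s + 1) * (s + 2)) * C (s + 2) z = of_nat (s\<^sup>2) * (\<Sum>m\<le>s + 2. a s m * (T m z / p ^ Suc m)) +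
      (\<Sum>m\<le>s + 2. of_nat (m * (m - 1)) * a s (m - 2) * (T m z / p ^ Suc m))"
    using C by simp
  also have "\<dots> = (\<Sum>m\<le>s + 2. (of_nat (s\<^sup>2) * a s m + of_nat (m * (m - 1)) * a s (m - 2)) * (T m z / p ^ Suc m))"
    unfolding sum_distrib_left sum.distrib[symmetric] by (intro sum.cong) (auto simp: algebra_simps)
  also have "\<dots> = of_nat ((s + 1) * (s + 2)) * (\<Sum>m\<le>s + 2. a (s + 2) m * (T m z / p ^ Suc m))"
    unfolding a_def arcsin_coeff_rec[symmetric] sum_distrib_left by (intro sum.cong) (auto simp: mult_ac)
  finally have "C (s + 2) z = (\<Sum>m\<le>s + 2. a (s + 2) m * (T m z / p ^ Suc m))"
    by (simp only: mult_cancel_left of_nat_eq_0_iff) simp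
  moreover have "T = trig_pfd (Suc (Suc s))"
    by (simp add: T_def trig_pfd_def fun_eq_iff)
  ultimately show ?case
    by (simp add: C_def a_def p_def)
qed

section \<open>Hyperbolic quotients on the line Re z = 1/2 and their integrals\<close>

definition sech_pole :: "nat \<Rightarrow> real" where
  "sech_pole j = pi * (of_nat j + 1 / 2)"

lemma sech_pole_pos: "sech_pole j > 0"
  by (simp add: sech_pole_def add_nonneg_pos)

text \<open>On the line Re z = 1/2, z + j = (b_j - i x) / pi and 1 - z + j is its conjugate, so each
  pair is w - cnj w = 2 i Im w. In particular the sum is purely imaginary.\<close>

lemma trig_pfd_on_line_sums:
  assumes "m \<ge> 1" "even (s + m)"
  shows "(\<lambda>j. (-1) ^ (s * j) * Im (inverse (Complex (sech_pole j) (- x)) ^ Suc m))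
           sums (Im (trig_pfd s m (1 / 2 - \<i> * of_real (x / pi)) / of_real pi ^ Suc m) / 2)"
    and "Re (trig_pfd s m (1 / 2 - \<i> * of_real (x / pi)) / of_real pi ^ Suc m) = 0"
proof -
  define z where "z = 1 / 2 - \<i> * of_real (x / pi)"
  have z: "0 < Re z" "Re z < 1"
    by (auto simp: z_def)
  have zj: "inverse (z + of_nat j) = of_real pi * inverse (Complex (sech_pole j) (- x))"
   and zj': "1 - z + of_nat j = cnj (z + of_nat j)" for j
  proof -
    have "z + of_nat j = Complex (sech_pole j) (- x) / of_real pi"
      by (simp add: z_def sech_pole_def complex_eq_iff)
    then show "inverse (z + of_nat j) = of_real pi * inverse (Complex (sech_pole j) (- x))"
      by (simp only: inverse_divide) (simp only: divide_inverse)
    show "1 - z + of_nat j = cnj (z + of_nat j)"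
      by (simp add: z_def complex_eq_iff)
  qed
  \<comment> \<open>The minus sign has two origins: for even s, m is even and (-1)^(m+1) = -1; for
    odd s it comes from the alternating signs.\<close>
  have sums: "(\<lambda>j. (-1) ^ (s * j) * (1 / (z + of_nat j) ^ Suc m - 1 / (1 - z + of_nat j) ^ Suc m))
      sums trig_pfd s m z"
  proof (cases "even s")
    case True
    then show ?thesis
      using cot_pfd_sums[OF z assms(1)] assms by (simp add: trig_pfd_def power_mult)
  next
    case False
    then show ?thesis
      using csc_pfd_sums[OF z, of m] assms by (simp add: trig_pfd_def power_mult)
  qed
  have t: "(-1) ^ (s * j) * (1 / (z + of_nat j) ^ Suc m - 1 / (1 - z + of_nat j) ^ Suc m) / of_real pi ^ Suc m
     = 2 * \<i> * of_real ((-1) ^ (s * j) * Im (inverse (Complex (sech_pole j) (- x)) ^ Suc m))" for j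
  proof -
    let ?w = "inverse (Complex (sech_pole j) (- x)) ^ Suc m"
    have "1 / (z + of_nat j) ^ Suc m = of_real pi ^ Suc m * ?w"
      by (metis zj power_inverse power_mult_distrib inverse_eq_divide)
    moreover from this have "1 / (1 - z + of_nat j) ^ Suc m = of_real pi ^ Suc m * cnj ?w"
      unfolding zj' by (metis complex_cnj_power complex_cnj_divide complex_cnj_one complex_cnj_mult complex_cnj_complex_of_real)
    ultimately have "(1 / (z + of_nat j) ^ Suc m - 1 / (1 - z + of_nat j) ^ Suc m) =
        of_real pi ^ Suc m * (?w - cnj ?w)"
      by (simp only: right_diff_distrib)
    also have "?w - cnj ?w = 2 * \<i> * of_real (Im ?w)"
      by (subst complex_diff_cnj) (simp add: mult_ac)
    finally show ?thesis
      by (simp del: power_Suc)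
  qed
  have S: "(\<lambda>j. 2 * \<i> * of_real ((-1) ^ (s * j) * Im (inverse (Complex (sech_pole j) (- x)) ^ Suc m)))
      sums (trig_pfd s m z / of_real pi ^ Suc m)"
    using sums_divide[OF sums, of "of_real pi ^ Suc m"] unfolding t .
  have r: "Re (2 * \<i> * of_real r) = 0" "Im (2 * \<i> * of_real r) = 2 * r" for r
    by simp_all
  show "(\<lambda>j. (-1) ^ (s * j) * Im (inverse (Complex (sech_pole j) (- x)) ^ Suc m))
           sums (Im (trig_pfd s m (1 / 2 - \<i> * of_real (x / pi)) / of_real pi ^ Suc m) / 2)"
    using sums_divide[OF sums_Im[OF S], of 2] unfolding r z_def by (simp del: power_Suc)
  show "Re (trig_pfd s m (1 / 2 - \<i> * of_real (x / pi)) / of_real pi ^ Suc m) = 0"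
    using sums_Re[OF S] unfolding r z_def by (simp only: sums_0 sums_iff) simp
qed

definition sech_pole_Im_sum :: "nat \<Rightarrow> nat \<Rightarrow> real \<Rightarrow> real" where
  "sech_pole_Im_sum s m x = (\<Sum>j. (-1) ^ (s * j) * Im (inverse (Complex (sech_pole j) (- x)) ^ Suc m))"

text \<open>At z = 1/2 - i x / pi, cos (pi z) = i sinh x and sin (pi z) = cosh x. The term m = 0
  drops out, because the constant series 1 has no coefficient at s >= 1.\<close>

lemma sinh_cosh_power_expansion:
  assumes "s \<ge> 1"
  shows "complex_of_real (sinh x / cosh x ^ Suc s) =
           (\<Sum>m = 1..s. arcsin_coeff 0 s m * of_real (2 * sech_pole_Im_sum s m x))"
proof -
  define z where "z = 1 / 2 - \<i> * of_real (x / pi)"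
  have z: "0 < Re z" "Re z < 1"
    by (auto simp: z_def)
  have u: "of_real pi * z = of_real pi / 2 - \<i> * of_real x"
    by (simp add: z_def algebra_simps)
  have sh: "sinh (complex_of_real x) = of_real (sinh x)" "cosh (complex_of_real x) = of_real (cosh x)"
    by (simp_all add: sinh_def cosh_def scaleR_conv_of_real exp_of_real flip: of_real_minus)
  have si: "sin (\<i> * complex_of_real x) = \<i> * of_real (sinh x)" "cos (\<i> * complex_of_real x) = of_real (cosh x)"
    unfolding sh[symmetric] by (simp_all add: sinh_conv_sin cosh_conv_cos)
  have c: "cos (of_real pi * z) = \<i> * of_real (sinh x)" "sin (of_real pi * z) = of_real (cosh x)"
    unfolding u by (simp_all add: cos_diff sin_diff si)
  have "\<i> * of_real (sinh x / cosh x ^ Suc s) = (\<Sum>m\<le>s. arcsin_coeff 0 s m * (trig_pfd s m z / of_real pi ^ Suc m))"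
    using cos_sin_power_expansion[OF z, of s] unfolding c by simp
  also have "\<dots> = (\<Sum>m = 1..s. arcsin_coeff 0 s m * (trig_pfd s m z / of_real pi ^ Suc m))"
  proof (rule sum.mono_neutral_right)
    show "\<forall>i\<in>{..s} - {1..s}. arcsin_coeff 0 s i * (trig_pfd s i z / of_real pi ^ Suc i) = 0"
    proof
      fix i assume "i \<in> {..s} - {1..s}"
      then have "i = 0" by auto
      moreover have "arcsin_coeff 0 s 0 = 0"
        using assms by (simp add: arcsin_coeff_def)
      ultimately show "arcsin_coeff 0 s i * (trig_pfd s i z / of_real pi ^ Suc i) = 0"
        by simp
    qed
  qed auto
  also have "\<dots> = (\<Sum>m = 1..s. \<i> * (arcsin_coeff 0 s m * of_real (2 * sech_pole_Im_sum s m x)))"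
  proof (rule sum.cong)
    fix m assume m: "m \<in> {1..s}"
    show "arcsin_coeff 0 s m * (trig_pfd s m z / of_real pi ^ Suc m) = \<i> * (arcsin_coeff 0 s m * of_real (2 * sech_pole_Im_sum s m x))"
    proof (cases "even (s + m)")
      case True
      then have "trig_pfd s m z / of_real pi ^ Suc m = \<i> * of_real (2 * sech_pole_Im_sum s m x)"
        using trig_pfd_on_line_sums[of m s x, folded z_def] m
        by (simp add: complex_eq_iff sech_pole_Im_sum_def sums_iff del: power_Suc)
      then show ?thesis
        by simp
    qed (simp add: arcsin_coeff_0_eq_0_if_odd)
  qed auto
  finally show ?thesis
    by (simp only: sum_distrib_left[symmetric] mult_cancel_left) simp
qed

text \<open>Twice the integral of \<open>sech_pole_Im_sum s m x / x\<close> when m >= 1 and s + m is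
  even: the factor pi is pi / 2 from each pole times the 2 of the expansion.\<close>

definition sech_pole_series :: "nat \<Rightarrow> nat \<Rightarrow> real" where
  "sech_pole_series s m = pi * (\<Sum>j. (-1) ^ (s * j) / sech_pole j ^ Suc m)"

lemma sech_pole_series_add_2: "sech_pole_series (s + 2) m = sech_pole_series s m"
  by (simp add: sech_pole_series_def power_add distrib_right power_mult)

lemma summable_sech_pole: "m \<ge> 1 \<Longrightarrow> summable (\<lambda>j. 1 / sech_pole j ^ Suc m)"
proof -
  assume m: "m \<ge> 1"
  have "summable (\<lambda>j. 1 / pi ^ Suc m * norm (1 / (1 / 2 + of_nat j :: complex) ^ Suc m))"
    by (intro summable_mult summable_inverse_power_shift m) auto
  moreover have "norm (1 / 2 + of_nat j :: complex) = real j + 1 / 2" for j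
  proof -
    have "1 / 2 + of_nat j = complex_of_real (real j + 1 / 2)"
      by simp
    then show ?thesis
      by (simp only: norm_of_real)
  qed
  ultimately show ?thesis
    by (simp add: sech_pole_def norm_divide norm_power power_mult_distrib del: power_Suc)
qed

lemma sech_pole_Im_sum_has_integral:
  assumes "m \<ge> 1" "even (s + m)"
  shows "((\<lambda>x. sech_pole_Im_sum s m x / x) has_integral sech_pole_series s m / 2) {0<..}"
proof -
  have "((\<lambda>x. sech_pole_Im_sum s m x / x) has_integral pi / 2 * (\<Sum>j. (-1) ^ (s * j) / sech_pole j ^ Suc m)) {0<..}"
    by (rule has_integral_sums_Im_inverse_Complex_power)
       (use assms trig_pfd_on_line_sums(1)[OF assms] in
         \<open>auto simp: sech_pole_pos summable_sech_pole sech_pole_Im_sum_def sums_iff simp del: power_Suc\<close>)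
  then show ?thesis
    by (simp add: sech_pole_series_def)
qed

text \<open>In the step to k + 1, sinh^2 = cosh^2 - 1 splits the integrand into the cases s - 2 and
  s of k; the hypothesis 2 (k + 1) < s is what makes 2 k < s - 2.\<close>

lemma sinh_cosh_quotient_has_integral:
  assumes "2 * k < s"
  shows "((\<lambda>x. complex_of_real (sinh x ^ (2 * k + 1) / (x * cosh x ^ Suc s))) has_integral
           (\<Sum>m = 1..s. arcsin_coeff k s m * of_real (sech_pole_series s m))) {0<..}"
  using assms
proof (induction k arbitrary: s)
  case 0
  have "((\<lambda>x. \<Sum>m = 1..s. arcsin_coeff 0 s m * of_real (2 * (sech_pole_Im_sum s m x / x))) has_integral
           (\<Sum>m = 1..s. arcsin_coeff 0 s m * of_real (sech_pole_series s m))) {0<..}"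
  proof (rule has_integral_sum)
    fix m assume m: "m \<in> {1..s}"
    show "((\<lambda>x. arcsin_coeff 0 s m * of_real (2 * (sech_pole_Im_sum s m x / x))) has_integral
           arcsin_coeff 0 s m * of_real (sech_pole_series s m)) {0<..}"
    proof (cases "even (s + m)")
      case True
      then have "((\<lambda>x. 2 * (sech_pole_Im_sum s m x / x)) has_integral 2 * (sech_pole_series s m / 2)) {0<..}"
        using m by (intro has_integral_mult_right sech_pole_Im_sum_has_integral) auto
      then have "((\<lambda>x. complex_of_real (2 * (sech_pole_Im_sum s m x / x))) has_integral of_real (2 * (sech_pole_series s m / 2))) {0<..}"
        by (rule has_integral_of_real)
      then show ?thesis
        by (intro has_integral_mult_right) simp
    qed (simp add: arcsin_coeff_0_eq_0_if_odd)
  qed auto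
  moreover have "(\<Sum>m = 1..s. arcsin_coeff 0 s m * of_real (2 * (sech_pole_Im_sum s m x / x))) =
      complex_of_real (sinh x ^ (2 * 0 + 1) / (x * cosh x ^ Suc s))" for x
  proof -
    have "complex_of_real (sinh x ^ (2 * 0 + 1) / (x * cosh x ^ Suc s)) =
        complex_of_real (sinh x / cosh x ^ Suc s) / of_real x"
      by simp
    also have "\<dots> = (\<Sum>m = 1..s. arcsin_coeff 0 s m * of_real (2 * (sech_pole_Im_sum s m x / x)))"
      using sinh_cosh_power_expansion[of s x] 0 by (simp add: sum_divide_distrib del: power_Suc)
    finally show ?thesis ..
  qed
  ultimately show ?case
    by simp
next
  case (Suc k)
  then obtain t where t: "s = t + 2"
    by (metis add.commute le_Suc_ex less_imp_le mult_Suc_right add_leD1)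
  have integrand: "complex_of_real (sinh x ^ (2 * k + 1) / (x * cosh x ^ Suc t)) -
            complex_of_real (sinh x ^ (2 * k + 1) / (x * cosh x ^ Suc (t + 2))) =
          complex_of_real (sinh x ^ (2 * Suc k + 1) / (x * cosh x ^ Suc s))" if "x \<in> {0<..}" for x
  proof -
    have ch: "cosh x \<noteq> 0" using cosh_real_pos[of x] by linarith
    have "sinh x ^ (2 * k + 1) / (x * cosh x ^ Suc t) - sinh x ^ (2 * k + 1) / (x * cosh x ^ Suc (t + 2)) =
        sinh x ^ (2 * k + 1) * ((cosh x)\<^sup>2 - 1) / (x * cosh x ^ Suc s)"
      using ch that unfolding t by (simp add: field_simps power2_eq_square)
    also have "(cosh x)\<^sup>2 - 1 = (sinh x)\<^sup>2"
      by (simp add: cosh_square_eq)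
    also have "sinh x ^ (2 * k + 1) * (sinh x)\<^sup>2 = sinh x ^ (2 * Suc k + 1)"
      by (simp add: power2_eq_square)
    finally show ?thesis
      by (metis of_real_diff)
  qed
  have "((\<lambda>x. complex_of_real (sinh x ^ (2 * k + 1) / (x * cosh x ^ Suc t)) -
            complex_of_real (sinh x ^ (2 * k + 1) / (x * cosh x ^ Suc (t + 2)))) has_integral
         (\<Sum>m = 1..t. arcsin_coeff k t m * of_real (sech_pole_series t m)) -
         (\<Sum>m = 1..t + 2. arcsin_coeff k (t + 2) m * of_real (sech_pole_series (t + 2) m))) {0<..}"
    using Suc t by (intro has_integral_diff Suc.IH) auto
  then have "((\<lambda>x. complex_of_real (sinh x ^ (2 * Suc k + 1) / (x * cosh x ^ Suc s))) has_integral
         (\<Sum>m = 1..t. arcsin_coeff k t m * of_real (sech_pole_series t m)) -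
         (\<Sum>m = 1..t + 2. arcsin_coeff k (t + 2) m * of_real (sech_pole_series (t + 2) m))) {0<..}"
    by (rule has_integral_eq[rotated]) (rule integrand)
  moreover have "(\<Sum>m = 1..t. arcsin_coeff k t m * of_real (sech_pole_series t m)) -
         (\<Sum>m = 1..t + 2. arcsin_coeff k (t + 2) m * of_real (sech_pole_series (t + 2) m)) =
         (\<Sum>m = 1..s. arcsin_coeff (Suc k) s m * of_real (sech_pole_series s m))"
  proof -
    \<comment> \<open>The two sums get the same range, as coefficients with m > t vanish, and the
      same series, which depends on s only through its parity.\<close>
    have "(\<Sum>m = 1..t. arcsin_coeff k t m * complex_of_real (sech_pole_series t m)) =
        (\<Sum>m = 1..t + 2. arcsin_coeff k t m * of_real (sech_pole_series (t + 2) m))"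
      unfolding sech_pole_series_add_2 by (intro sum.mono_neutral_left) (auto simp: arcsin_coeff_eq_0_if_less)
    then show ?thesis
      unfolding t arcsin_coeff_rec_Suc by (simp only: left_diff_distrib sum_subtractf)
  qed
  ultimately show ?case
    by (simp only:)
qed

section \<open>Values of the pole series in terms of zeta and beta\<close>

lemma sech_pole_eq: "sech_pole j = pi / 2 * of_nat (2 * j + 1)"
  by (simp add: sech_pole_def algebra_simps)

lemma of_nat_powr_minus_of_nat:
  "j > 0 \<Longrightarrow> (of_nat j :: complex) powr (- of_nat m) = 1 / of_nat j ^ m"
  by (simp add: powr_minus powr_nat' inverse_eq_divide)

text \<open>As sech_pole j = (pi/2)(2j + 1), the series is a sum over odd denominators, that is (1 -
  2^(-M)) zeta(M) with M = 2p + 1; the scaling by 2^M / pi^(2p) turns this factor into 2^M -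
  1.\<close>

lemma sech_pole_series_even:
  assumes "p \<ge> 1" "even s"
  shows "complex_of_real (sech_pole_series s (2 * p)) =
    (2 ^ (2 * p + 1) - 1) * (riemann_zeta (of_nat (2 * p + 1)) / of_real pi ^ (2 * p))"
proof -
  let ?M = "Suc (2 * p)"
  have "(\<lambda>j. 1 / sech_pole j ^ ?M) sums (sech_pole_series s (2 * p) / pi)"
    using summable_sech_pole[of "2 * p"] assms by (simp add: sech_pole_series_def sums_iff power_mult del: power_Suc)
  then have "(\<lambda>j. (pi / 2) ^ ?M * (1 / sech_pole j ^ ?M)) sums ((pi / 2) ^ ?M * (sech_pole_series s (2 * p) / pi))"
    by (rule sums_mult)
  moreover have "(pi / 2) ^ ?M * (1 / sech_pole j ^ ?M) = 1 / of_nat (2 * j + 1) ^ ?M" for j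
    by (simp only: sech_pole_eq power_mult_distrib) (simp del: power_Suc of_nat_add of_nat_mult of_nat_Suc)
  ultimately have "(\<lambda>j. 1 / of_nat (2 * j + 1) ^ ?M) sums ((pi / 2) ^ ?M * (sech_pole_series s (2 * p) / pi))"
    by simp
  then have "(\<lambda>j. of_real (1 / of_nat (2 * j + 1) ^ ?M) :: complex) sums of_real ((pi / 2) ^ ?M * (sech_pole_series s (2 * p) / pi))"
    by (rule sums_of_real)
  then have o: "(\<lambda>j. 1 / of_nat (Suc (2 * j)) ^ ?M :: complex) sums of_real ((pi / 2) ^ ?M * (sech_pole_series s (2 * p) / pi))"
    by (simp del: power_Suc)
  \<comment> \<open>Because of the shift \<open>Suc j\<close>, even indices carry the odd
    denominators; odd indices reproduce the whole series divided by 2^M.\<close>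
  define f :: "nat \<Rightarrow> complex" where "f j = 1 / of_nat (Suc j) ^ ?M" for j
  have f: "summable f"
  proof -
    have "summable (\<lambda>j. norm (1 / (1 + of_nat j :: complex) ^ ?M))"
      using assms by (intro summable_inverse_power_shift) auto
    then have "summable (\<lambda>j. 1 / (1 + of_nat j :: complex) ^ ?M)"
      by (rule summable_norm_cancel)
    then show ?thesis
      by (simp add: f_def[abs_def] del: power_Suc)
  qed
  have z: "riemann_zeta (of_nat (2 * p + 1)) = suminf f"
    unfolding riemann_zeta_def f_def by (simp add: of_nat_powr_minus_of_nat del: of_nat_Suc of_nat_add of_nat_mult power_Suc)
  have e: "(\<lambda>j. f (2 * j + 1)) sums (suminf f / 2 ^ ?M)"
  proof -
    have "f (2 * j + 1) = f j / 2 ^ ?M" for j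
    proof -
      have "Suc (2 * j + 1) = 2 * Suc j" by simp
      then show ?thesis
        unfolding f_def by (simp only: of_nat_mult power_mult_distrib) (simp del: power_Suc of_nat_Suc)
    qed
    then show ?thesis
      using sums_divide[OF summable_sums[OF f]] by simp
  qed
  have "(\<lambda>j. f (2 * j)) sums of_real ((pi / 2) ^ ?M * (sech_pole_series s (2 * p) / pi))"
    unfolding f_def by (rule o)
  from this e have "f sums (of_real ((pi / 2) ^ ?M * (sech_pole_series s (2 * p) / pi)) + suminf f / 2 ^ ?M)"
    by (rule sums_pairs[OF f sums_add])
  then have "suminf f = of_real ((pi / 2) ^ ?M * (sech_pole_series s (2 * p) / pi)) + suminf f / 2 ^ ?M"
    by (simp add: sums_iff)
  also have "(pi / 2) ^ ?M * (sech_pole_series s (2 * p) / pi) = pi ^ (2 * p) / 2 ^ ?M * sech_pole_series s (2 * p)"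
    by (simp add: power_divide)
  finally have "suminf f * 2 ^ ?M = of_real pi ^ (2 * p) * of_real (sech_pole_series s (2 * p)) + suminf f"
    by (simp add: field_simps del: power_Suc)
  then have "of_real pi ^ (2 * p) * of_real (sech_pole_series s (2 * p)) = (2 ^ ?M - 1) * suminf f"
    by (simp add: algebra_simps)
  then show ?thesis
    unfolding z by (simp add: field_simps)
qed

text \<open>For odd s the signs are (-1)^j, so the series is already that of beta, and only the
  scaling by (pi/2)^(2p) contributes the power of 2.\<close>

lemma sech_pole_series_odd:
  assumes "p \<ge> 1" "odd s"
  shows "complex_of_real (sech_pole_series s (2 * p - 1)) =
    2 ^ (2 * p) * (dirichlet_beta (of_nat (2 * p)) / of_real pi ^ (2 * p - 1))"
proof -
  obtain q where q: "2 * p = Suc q" "q \<ge> 1"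
    using assms by (cases p) auto
  let ?f = "\<lambda>j. (-1) ^ (s * j) / sech_pole j ^ Suc q"
  have "summable ?f"
    by (rule summable_comparison_test[OF _ summable_sech_pole[OF q(2)]])
       (auto simp: norm_divide norm_power sech_pole_pos less_imp_le simp del: power_Suc)
  then have "?f sums (sech_pole_series s q / pi)"
    by (simp add: sech_pole_series_def sums_iff del: power_Suc)
  then have "(\<lambda>j. of_real (?f j)) sums complex_of_real (sech_pole_series s q / pi)"
    by (rule sums_of_real)
  then have "(\<lambda>j. (of_real pi / 2) ^ Suc q * of_real (?f j)) sums
      ((of_real pi / 2) ^ Suc q * complex_of_real (sech_pole_series s q / pi))"
    by (rule sums_mult)
  moreover have "(of_real pi / 2) ^ Suc q * of_real (?f j) =
     (-1) ^ j * (of_nat (2 * j + 1) :: complex) powr (- of_nat (2 * p))" for j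
  proof -
    have "(-1 :: real) ^ (s * j) = (-1) ^ j"
      using assms by (simp add: power_mult)
    then have "(of_real pi / 2) ^ Suc q * of_real (?f j) = (-1) ^ j * (1 / complex_of_nat (2 * j + 1) ^ Suc q)"
      by (simp add: sech_pole_eq power_mult_distrib power_divide del: power_Suc of_nat_add of_nat_mult of_nat_Suc)
    then show ?thesis
      unfolding q(1) by (simp add: of_nat_powr_minus_of_nat del: of_nat_Suc of_nat_add of_nat_mult power_Suc)
  qed
  ultimately have "dirichlet_beta (of_nat (2 * p)) = (of_real pi / 2) ^ Suc q * complex_of_real (sech_pole_series s q / pi)"
    unfolding dirichlet_beta_def by (simp only: sums_iff)
  also have "\<dots> = of_real pi ^ q / 2 ^ Suc q * of_real (sech_pole_series s q)"
    by (simp add: power_divide)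
  finally have "of_real pi ^ q * of_real (sech_pole_series s q) = 2 ^ Suc q * dirichlet_beta (of_nat (2 * p))"
    by (simp del: power_Suc)
  then have "of_real (sech_pole_series s q) = 2 ^ Suc q * (dirichlet_beta (of_nat (2 * p)) / of_real pi ^ q)"
    by (simp add: field_simps del: power_Suc)
  then show ?thesis
    using q by simp
qed

lemma sum_even_part:
  fixes f :: "nat \<Rightarrow> 'a :: comm_monoid_add"
  assumes "\<And>m. odd m \<Longrightarrow> f m = 0"
  shows "(\<Sum>m = 1..2 * n. f m) = (\<Sum>p = 1..n. f (2 * p))"
  by (induction n) (auto simp: assms)

lemma sum_odd_part:
  fixes f :: "nat \<Rightarrow> 'a :: comm_monoid_add"
  assumes "\<And>m. even m \<Longrightarrow> f m = 0"
  shows "(\<Sum>m = 1..2 * n. f m) = (\<Sum>p = 1..n. f (2 * p - 1))"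
  by (induction n) (auto simp: assms)

theorem corollary1p3:
  fixes n k :: nat
  assumes "n \<ge> 1" and "k < n"
  shows "((\<lambda>x::real. complex_of_real (sinh x ^ (2 * k + 1) / (x * cosh x ^ (2 * n + 1))))
            has_integral
          (\<Sum>p = 1..n. (2 ^ (2 * p + 1) - 1)
             * fps_nth (fps_expansion (\<lambda>z. (z ^ 2 - 1) ^ k * Arcsin z ^ (2 * p)) 0) (2 * n)
             * (riemann_zeta (of_nat (2 * p + 1)) / complex_of_real pi ^ (2 * p)))) {0<..}
       \<and>
         ((\<lambda>x::real. complex_of_real (sinh x ^ (2 * k + 1) / (x * cosh x ^ (2 * n))))
            has_integral
          (\<Sum>p = 1..n. 2 ^ (2 * p)
             * fps_nth (fps_expansion (\<lambda>z. (z ^ 2 - 1) ^ k * Arcsin z ^ (2 * p - 1)) 0) (2 * n - 1)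
             * (dirichlet_beta (of_nat (2 * p)) / complex_of_real pi ^ (2 * p - 1)))) {0<..}"
proof
  have "(\<Sum>m = 1..2 * n. arcsin_coeff k (2 * n) m * of_real (sech_pole_series (2 * n) m)) =
      (\<Sum>p = 1..n. arcsin_coeff k (2 * n) (2 * p) * of_real (sech_pole_series (2 * n) (2 * p)))"
    by (rule sum_even_part) (simp add: arcsin_coeff_eq_0_if_odd)
  also have "\<dots> = (\<Sum>p = 1..n. (2 ^ (2 * p + 1) - 1)
             * fps_nth (fps_expansion (\<lambda>z. (z ^ 2 - 1) ^ k * Arcsin z ^ (2 * p)) 0) (2 * n)
             * (riemann_zeta (of_nat (2 * p + 1)) / complex_of_real pi ^ (2 * p)))"
    unfolding fps_nth_expansion_Arcsin
    by (intro sum.cong refl, subst sech_pole_series_even) (auto simp: mult_ac)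
  finally show "((\<lambda>x::real. complex_of_real (sinh x ^ (2 * k + 1) / (x * cosh x ^ (2 * n + 1))))
            has_integral
          (\<Sum>p = 1..n. (2 ^ (2 * p + 1) - 1)
             * fps_nth (fps_expansion (\<lambda>z. (z ^ 2 - 1) ^ k * Arcsin z ^ (2 * p)) 0) (2 * n)
             * (riemann_zeta (of_nat (2 * p + 1)) / complex_of_real pi ^ (2 * p)))) {0<..}"
    using sinh_cosh_quotient_has_integral[of k "2 * n"] assms by simp
next
  \<comment> \<open>The vanishing term m = 2n is added so that the range becomes the one which
    \<open>sum_odd_part\<close> splits.\<close>
  have "(\<Sum>m = 1..2 * n - 1. arcsin_coeff k (2 * n - 1) m * of_real (sech_pole_series (2 * n - 1) m)) =
      (\<Sum>m = 1..2 * n. arcsin_coeff k (2 * n - 1) m * of_real (sech_pole_series (2 * n - 1) m))"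
    by (rule sum.mono_neutral_left) (use assms in \<open>auto simp: arcsin_coeff_eq_0_if_less\<close>)
  also have "\<dots> = (\<Sum>p = 1..n. arcsin_coeff k (2 * n - 1) (2 * p - 1) * of_real (sech_pole_series (2 * n - 1) (2 * p - 1)))"
    by (rule sum_odd_part) (use assms in \<open>simp add: arcsin_coeff_eq_0_if_odd\<close>)
  also have "\<dots> = (\<Sum>p = 1..n. 2 ^ (2 * p)
             * fps_nth (fps_expansion (\<lambda>z. (z ^ 2 - 1) ^ k * Arcsin z ^ (2 * p - 1)) 0) (2 * n - 1)
             * (dirichlet_beta (of_nat (2 * p)) / complex_of_real pi ^ (2 * p - 1)))"
    unfolding fps_nth_expansion_Arcsin
    by (intro sum.cong refl, subst sech_pole_series_odd) (use assms in \<open>auto simp: mult_ac\<close>)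
  finally show "((\<lambda>x::real. complex_of_real (sinh x ^ (2 * k + 1) / (x * cosh x ^ (2 * n))))
            has_integral
          (\<Sum>p = 1..n. 2 ^ (2 * p)
             * fps_nth (fps_expansion (\<lambda>z. (z ^ 2 - 1) ^ k * Arcsin z ^ (2 * p - 1)) 0) (2 * n - 1)
             * (dirichlet_beta (of_nat (2 * p)) / complex_of_real pi ^ (2 * p - 1)))) {0<..}"
    using sinh_cosh_quotient_has_integral[of k "2 * n - 1"] assms by simp
qed

end
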